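(* Let $K$ be a field of characteristic $p>0$, let $k=\bigcap_{n\ge 0}K^{p^n}$, and assume $K/k$ is a finitely generated field extension. There are natural bijections between the following three sets: (1) power towers on $K$; (2) Jacobson sequences on $K$; (3) $K$-subalgebras $\mathcal{D}$ with $K\subseteq \mathcal{D}\subseteq \operatorname{Diff}_k(K)$. These bijections are given explicitly by: (a) power tower to Jacobson sequence: $W_\bullet\mapsto (T_{W_0/W_1},T_{W_1/W_2},T_{W_2/W_3},\ldots)$; (b) Jacobson sequence to power tower: $(\mathcal{F}_1,\mathcal{F}_2,\ldots)\mapsto (W_n)_{n\ge 0}$ with $W_0=K$ and $W_n=\operatorname{Ann}(\mathcal{F}_n)$ for $n\ge 1$; (c) power tower to subalgebra: $W_\bullet\mapsto \operatorname{Diff}_{W_\bullet}(K):=\bigcup_{n\ge 0}\operatorname{Diff}_{W_n}(K)$; (d) subalgebra to Jacobson sequence ("unpacking"): $\mathcal{D}\mapsto(\mathcal{F}_1,\mathcal{F}_2,\ldots)$ with $\mathcal{F}_1=\mathcal{D}\cap TK$ and $\mathcal{F}_n=d(K/W_{n-1})(\mathcal{D})\cap TW_{n-1}$ for $n\ge 1$, where $W_\bullet$ is the power tower corresponding to $\mathcal{D}$, namely $W_m=\{x\in K: xE=Ex \text{ for all } E\in \mathcal{D}\cap\operatorname{Diff}_{K^{p^m}}(K)\}$. Moreover, for a power tower $W_\bullet$ with associated Jacobson sequence $(\mathcal{F}_i)$, the ranks $\operatorname{rk}(\mathcal{F}_i):=\dim_{W_{i-1}}(\mathcal{F}_i)$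 are finite and nonincreasing, $\operatorname{rk}(\mathcal{F}_i)\ge\operatorname{rk}(\mathcal{F}_{i+1})$, and $p^{\operatorname{rk}(\mathcal{F}_i)}=\dim_{W_i}(W_{i-1})$ for all $i\ge 1$.
   Context: A power tower on $K$ is a sequence of subfields $W_0,W_1,W_2,\ldots$ of $K$ such that $W_j=W_i\cdot K^{p^j}$ whenever $j\le i$ (here $\cdot$ denotes the compositum in $K$; in particular $W_0=K$). For a field $F$ of characteristic $p$, $TF$ denotes the $F$-vector space of derivations of $F$, and for a subfield $A\subseteq F$, $T_{F/A}$ denotes the derivations of $F$ vanishing on $A$. A $p$-Lie algebra on $F$ is an $F$-subspace $L\subseteq TF$ closed under the commutator $[D,E]=DE-ED$ and under $p$-th powers $D\mapsto D^p$ (the $p$-fold composite). For such $L$, $\operatorname{Ann}(L)=\{x\in F: D(x)=0\ \forall D\in L\}$. A Jacobson sequence on $K$ is a sequence $(\mathcal{F}_1,\mathcal{F}_2,\ldots)$ with $\mathcal{F}_1$ a $p$-Lie algebra on $K$ and, for each $i\ge 1$, $\mathcal{F}_{i+1}$ a $p$-Lie algebra on the field $\operatorname{Ann}(\mathcal{F}_i)$ with $\mathcal{F}_{i+1}\cap T_{\operatorname{Ann}(\mathcal{F}_i)/K^{p^i}}=0$. For subfields $A\subseteq B$, $\operatorname{Diff}_A(B)$ is the algebra of differential operators on $B$ relative to $A$: the union over $n\ge 0$ of the sets of $A$-linear maps $D:B\to B$ such that $[b_0,[b_1,[\ldots,[b_n,D]\ldots]]]=0$ for all $b_0,\ldots,b_n\in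 B$ (elements of $B$ acting by multiplication); it is a subalgebra of $\operatorname{End}_A(B)$ containing $B$. For a subfield $k\subseteq W\subseteq K$, the differential $d(K/W)$ sends $D\in\operatorname{Diff}_k(K)$ to its restriction $D|_W:W\to K$; its image lies in $\operatorname{Diff}_k(W)\otimes_W K$, identified with the $K$-linear span in $\operatorname{Hom}(W,K)$ of the maps $\iota\circ E$, $E\in \operatorname{Diff}_k(W)$, $\iota:W\to K$ the inclusion; $TW$ is viewed inside it via $E\mapsto\iota\circ E$. For $W=K$, $d(K/K)$ is the identity. *)

theory Defs
  imports Main
begin

text \<open>Ambient field: K = UNIV of a type 'a :: field with CHAR('a) = p > 0.
  Subfields of K are sets of 'a.  Derivations / operators are functions 'a => 'a;
  a derivation of a subfield F is represented extensionally (value 0 outside F).\<close>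

definition subfield :: "'a::field set \<Rightarrow> bool" where
  "subfield F \<longleftrightarrow> 0 \<in> F \<and> 1 \<in> F \<and>
     (\<forall>x\<in>F. \<forall>y\<in>F. x + y \<in> F \<and> x * y \<in> F) \<and>
     (\<forall>x\<in>F. - x \<in> F \<and> inverse x \<in> F)"

definition gen_field :: "'a::field set \<Rightarrow> 'a set" where
  "gen_field X = \<Inter> {F. subfield F \<and> X \<subseteq> F}"

definition compositum :: "'a::field set \<Rightarrow> 'a set \<Rightarrow> 'a set" where
  "compositum A B = gen_field (A \<union> B)"

definition ppow_field :: "nat \<Rightarrow> 'a::field set" where
  "ppow_field n = range (\<lambda>x::'a. x ^ (CHAR('a) ^ n))"

definition perfect_core :: "'a::field set" where
  "perfect_core = (\<Inter>n. ppow_field n)"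

definition fin_gen_over :: "'a::field set \<Rightarrow> bool" where
  "fin_gen_over k \<longleftrightarrow> (\<exists>S. finite S \<and> gen_field (k \<union> S) = UNIV)"

definition power_tower :: "(nat \<Rightarrow> 'a::field set) \<Rightarrow> bool" where
  "power_tower W \<longleftrightarrow> (\<forall>i. subfield (W i)) \<and>
     (\<forall>i j. j \<le> i \<longrightarrow> W j = compositum (W i) (ppow_field j))"

definition derivation :: "'a::field set \<Rightarrow> ('a \<Rightarrow> 'a) \<Rightarrow> bool" where
  "derivation F D \<longleftrightarrow> (\<forall>x. x \<notin> F \<longrightarrow> D x = 0) \<and> (\<forall>x\<in>F. D x \<in> F) \<and>
     (\<forall>x\<in>F. \<forall>y\<in>F. D (x + y) = D x + D y \<and> D (x * y) = x * D y + y * D x)"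

definition Der :: "'a::field set \<Rightarrow> ('a \<Rightarrow> 'a) set" where
  "Der F = {D. derivation F D}"

definition RelDer :: "'a::field set \<Rightarrow> 'a set \<Rightarrow> ('a \<Rightarrow> 'a) set" where
  "RelDer F A = {D. derivation F D \<and> (\<forall>a\<in>A. D a = 0)}"

definition p_lie :: "'a::field set \<Rightarrow> ('a \<Rightarrow> 'a) set \<Rightarrow> bool" where
  "p_lie F L \<longleftrightarrow> L \<subseteq> Der F \<and> (\<lambda>x. 0) \<in> L \<and>
     (\<forall>D\<in>L. \<forall>E\<in>L. (\<lambda>x. D x + E x) \<in> L) \<and>
     (\<forall>c\<in>F. \<forall>D\<in>L. (\<lambda>x. c * D x) \<in> L) \<and>
     (\<forall>D\<in>L. \<forall>E\<in>L. (\<lambda>x. D (E x) - E (D x)) \<in> L) \<and>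
     (\<forall>D\<in>L. (D ^^ CHAR('a)) \<in> L)"

definition Ann :: "'a::field set \<Rightarrow> ('a \<Rightarrow> 'a) set \<Rightarrow> 'a set" where
  "Ann F L = {x \<in> F. \<forall>D\<in>L. D x = 0}"

text \<open>Jacobson sequences are indexed from 0: \<open>F i\<close> stands for the paper's F_(i+1).
  \<open>jac_field F i\<close> is the field on which \<open>F i\<close> lives: K for i = 0, Ann(F_i) otherwise.\<close>
primrec jac_field :: "(nat \<Rightarrow> ('a::field \<Rightarrow> 'a) set) \<Rightarrow> nat \<Rightarrow> 'a set" where
  "jac_field F 0 = UNIV"
| "jac_field F (Suc n) = Ann (jac_field F n) (F n)"

definition jacobson_seq :: "(nat \<Rightarrow> ('a::field \<Rightarrow> 'a) set) \<Rightarrow> bool" where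
  "jacobson_seq F \<longleftrightarrow> p_lie UNIV (F 0) \<and>
     (\<forall>i\<ge>1. p_lie (jac_field F i) (F i) \<and>
             F i \<inter> RelDer (jac_field F i) (ppow_field i) = {\<lambda>x. 0})"

definition ad_op :: "'a::field \<Rightarrow> ('a \<Rightarrow> 'a) \<Rightarrow> ('a \<Rightarrow> 'a)" where
  "ad_op b D = (\<lambda>x. b * D x - D (b * x))"

primrec nested_zero :: "nat \<Rightarrow> ('a::field \<Rightarrow> 'a) \<Rightarrow> bool" where
  "nested_zero 0 D = (\<forall>b. ad_op b D = (\<lambda>x. 0))"
| "nested_zero (Suc n) D = (\<forall>b. nested_zero n (ad_op b D))"

definition Diff :: "'a::field set \<Rightarrow> ('a \<Rightarrow> 'a) set" where
  "Diff A = {D. (\<forall>x y. D (x + y) = D x + D y) \<and> (\<forall>a\<in>A. \<forall>x. D (a * x) = a * D x) \<and>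
                (\<exists>n. nested_zero n D)}"

definition K_subalg :: "('a::field \<Rightarrow> 'a) set \<Rightarrow> bool" where
  "K_subalg DD \<longleftrightarrow> (\<forall>c. (\<lambda>x. c * x) \<in> DD) \<and> DD \<subseteq> Diff perfect_core \<and>
     (\<forall>D\<in>DD. \<forall>E\<in>DD. (\<lambda>x. D x + E x) \<in> DD) \<and>
     (\<forall>c. \<forall>D\<in>DD. (\<lambda>x. c * D x) \<in> DD) \<and>
     (\<forall>D\<in>DD. \<forall>E\<in>DD. D \<circ> E \<in> DD)"

definition tower_to_jac :: "(nat \<Rightarrow> 'a::field set) \<Rightarrow> nat \<Rightarrow> ('a \<Rightarrow> 'a) set" where
  "tower_to_jac W = (\<lambda>i. RelDer (W i) (W (Suc i)))"

definition jac_to_tower :: "(nat \<Rightarrow> ('a::field \<Rightarrow> 'a) set) \<Rightarrow> nat \<Rightarrow> 'a set" where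
  "jac_to_tower F = jac_field F"

definition tower_to_alg :: "(nat \<Rightarrow> 'a::field set) \<Rightarrow> ('a \<Rightarrow> 'a) set" where
  "tower_to_alg W = (\<Union>n. Diff (W n))"

definition alg_to_tower :: "('a::field \<Rightarrow> 'a) set \<Rightarrow> nat \<Rightarrow> 'a set" where
  "alg_to_tower DD m = {x. \<forall>E \<in> DD \<inter> Diff (ppow_field m). \<forall>y. x * E y = E (x * y)}"

text \<open>Restriction d(K/W)(D) = D|_W : W \<rightarrow> K, represented extensionally.\<close>
definition restr :: "'a set \<Rightarrow> ('a \<Rightarrow> 'a::zero) \<Rightarrow> ('a \<Rightarrow> 'a)" where
  "restr W D = (\<lambda>x. if x \<in> W then D x else 0)"

text \<open>(d) unpacking (shifted index: component i is the paper's F_(i+1)).\<close>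
definition unpack :: "('a::field \<Rightarrow> 'a) set \<Rightarrow> nat \<Rightarrow> ('a \<Rightarrow> 'a) set" where
  "unpack DD = (\<lambda>i. {E \<in> Der (alg_to_tower DD i). \<exists>D\<in>DD. E = restr (alg_to_tower DD i) D})"

definition ext_has_dim :: "'a::field set \<Rightarrow> 'a set \<Rightarrow> nat \<Rightarrow> bool" where
  "ext_has_dim A B n \<longleftrightarrow> (\<exists>b::nat \<Rightarrow> 'a. (\<forall>i<n. b i \<in> B) \<and>
     (\<forall>c. (\<forall>i<n. c i \<in> A) \<longrightarrow> (\<Sum>i<n. c i * b i) = 0 \<longrightarrow> (\<forall>i<n. c i = 0)) \<and>
     (\<forall>x\<in>B. \<exists>c. (\<forall>i<n. c i \<in> A) \<and> x = (\<Sum>i<n. c i * b i)))"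

definition der_has_dim :: "'a::field set \<Rightarrow> ('a \<Rightarrow> 'a) set \<Rightarrow> nat \<Rightarrow> bool" where
  "der_has_dim A L n \<longleftrightarrow> (\<exists>b::nat \<Rightarrow> ('a \<Rightarrow> 'a). (\<forall>i<n. b i \<in> L) \<and>
     (\<forall>c. (\<forall>i<n. c i \<in> A) \<longrightarrow> (\<lambda>x. \<Sum>i<n. c i * b i x) = (\<lambda>x. 0) \<longrightarrow> (\<forall>i<n. c i = 0)) \<and>
     (\<forall>D\<in>L. \<exists>c. (\<forall>i<n. c i \<in> A) \<and> D = (\<lambda>x. \<Sum>i<n. c i * b i x)))"

end

theory Submission
  imports Defs "HOL-Computational_Algebra.Polynomial" "HOL-Computational_Algebra.Primes"
begin

text \<open>Since \<open>K\<close> is finite over every \<open>K^{p^n}\<close>, the operators in \<open>Diff_A(K)\<close> with \<open>K^{p^n} \<subseteq> A\<close> are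
  the \<open>A\<close>-linear endomorphisms of \<open>K\<close>: commutators with elements of \<open>K\<close> commute, are nilpotent
  and depend linearly on the element. Conversely an operator of order less than \<open>p^n\<close> commutes with
  \<open>K^{p^n}\<close>, because \<open>ad(b)^{p^n} = ad(b^{p^n})\<close>. The Jacobson--Bourbaki density argument then matches
  each layer \<open>\<D> \<inter> Diff_{K^{p^n}}(K)\<close> with its centralizer \<open>W_n\<close>, and intersecting layers corresponds to
  the compositum \<open>W_n = W_m K^{p^n}\<close>.

  On the side of derivations, a \<open>p\<close>-Lie algebra whose elements are determined by finitely many values
  has a basis \<open>D_1, \<dots>, D_r\<close> dual to elements \<open>x_1, \<dots>, x_r\<close>. Brackets and \<open>p\<close>-th powers of the \<open>D_i\<close> kill
  all \<open>x_j\<close>, so the \<open>D_i\<close> commute and \<open>D_i^p = 0\<close>; Taylor expansion shows that the monomials in the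
  \<open>x_j\<close> with exponents below \<open>p\<close> form a basis over the annihilator. This gives Jacobson's correspondence
  in height one and the dimension formula. In a Jacobson sequence the finiteness comes from the
  transversality condition: an element of \<open>\<F>_{i+1}\<close> is determined on \<open>K^{p^i}\<close>, hence by its values on
  the \<open>p^i\<close>-th powers of generators of \<open>K\<close>. Since the \<open>p\<close>-th powers of \<open>x_1, \<dots>, x_r\<close> again determine the
  derivations of the next level, the ranks do not increase.\<close>

section \<open>Subfields, subspaces and Frobenius\<close>

lemma subfield_closed:
  assumes "subfield F"
  shows "0 \<in> F" "1 \<in> F" "x \<in> F \<Longrightarrow> y \<in> F \<Longrightarrow> x + y \<in> F" "x \<in> F \<Longrightarrow> y \<in> F \<Longrightarrow> x * y \<in> F"
    "x \<in> F \<Longrightarrow> - x \<in> F" "x \<in> F \<Longrightarrow> inverse x \<in> F" "x \<in> F \<Longrightarrow> y \<in> F \<Longrightarrow> x - y \<in> F"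
    "x \<in> F \<Longrightarrow> y \<in> F \<Longrightarrow> x / y \<in> F"
  using assms unfolding subfield_def diff_conv_add_uminus divide_inverse by blast+

lemma subfield_power: "subfield F \<Longrightarrow> x \<in> F \<Longrightarrow> x ^ n \<in> F"
  by (induction n) (auto intro: subfield_closed)

lemma subfield_sum: "subfield F \<Longrightarrow> (\<And>i. i \<in> I \<Longrightarrow> f i \<in> F) \<Longrightarrow> sum f I \<in> F"
  by (induction I rule: infinite_finite_induct) (auto intro: subfield_closed)

lemma subfield_of_nat: "subfield F \<Longrightarrow> of_nat n \<in> F"
  by (induction n) (auto intro: subfield_closed)

lemma subfield_UNIV: "subfield UNIV"
  by (simp add: subfield_def)

lemma subfield_gen_field: "subfield (gen_field X)"
  unfolding gen_field_def subfield_def by auto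

lemma gen_field_superset: "X \<subseteq> gen_field X"
  unfolding gen_field_def by auto

lemma gen_field_least: "subfield F \<Longrightarrow> X \<subseteq> F \<Longrightarrow> gen_field X \<subseteq> F"
  unfolding gen_field_def by auto

lemma gen_field_mono: "X \<subseteq> Y \<Longrightarrow> gen_field X \<subseteq> gen_field Y"
  unfolding gen_field_def by auto

lemma subfield_compositum: "subfield (compositum A B)"
  by (simp add: compositum_def subfield_gen_field)

lemma compositum_superset: "A \<subseteq> compositum A B" "B \<subseteq> compositum A B"
  using gen_field_superset[of "A \<union> B"] by (auto simp: compositum_def)

lemma compositum_least: "subfield F \<Longrightarrow> A \<subseteq> F \<Longrightarrow> B \<subseteq> F \<Longrightarrow> compositum A B \<subseteq> F"
  by (simp add: compositum_def gen_field_least)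

lemma ppow_field_0 [simp]: "ppow_field 0 = UNIV"
  by (simp add: ppow_field_def)

lemma ppow_field_power: "x \<in> ppow_field m \<Longrightarrow> x ^ (CHAR('a::field) ^ n) \<in> (ppow_field (m + n) :: 'a set)"
  unfolding ppow_field_def power_add by (auto simp: power_mult intro: rangeI)

lemma ppow_field_rep: "(x :: 'a::field) \<in> ppow_field (m + n) \<Longrightarrow> \<exists>y \<in> ppow_field m. x = y ^ (CHAR('a) ^ n)"
  unfolding ppow_field_def power_add by (auto simp: power_mult)

lemma ppow_field_antimono: "m \<le> n \<Longrightarrow> ppow_field n \<subseteq> (ppow_field m :: 'a::field set)"
  using ppow_field_rep[of _ "n - m" m] by (auto simp: ppow_field_def)

lemma perfect_core_subset: "perfect_core \<subseteq> ppow_field n"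
  unfolding perfect_core_def by auto

section \<open>Subspaces over a subfield and finite spanning lists\<close>

definition subspace_over :: "'a::field set \<Rightarrow> 'a set \<Rightarrow> bool" where
  "subspace_over A V \<longleftrightarrow> 0 \<in> V \<and> (\<forall>x\<in>V. \<forall>y\<in>V. x + y \<in> V) \<and> (\<forall>a\<in>A. \<forall>x\<in>V. a * x \<in> V)"

text \<open>Recursion over a list matches the later arguments, which extend or interpolate linear
  maps one vector at a time and never fix a basis.\<close>

primrec lspan :: "'a::field set \<Rightarrow> 'a list \<Rightarrow> 'a set" where
  "lspan A [] = {0}"
| "lspan A (y # xs) = {v + a * y |v a. v \<in> lspan A xs \<and> a \<in> A}"

lemma subspace_over_closed:
  assumes "subspace_over A V"
  shows "0 \<in> V" "x \<in> V \<Longrightarrow> y \<in> V \<Longrightarrow> x + y \<in> V" "a \<in> A \<Longrightarrow> x \<in> V \<Longrightarrow> a * x \<in> V"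
  using assms unfolding subspace_over_def by auto

lemma subspace_over_minus:
  assumes "subfield A" "subspace_over A V" "x \<in> V" "y \<in> V"
  shows "x - y \<in> V"
  using subspace_over_closed(2)[OF assms(2,3) subspace_over_closed(3)[OF assms(2), of "-1" y]]
    subfield_closed(2,5)[OF assms(1)] assms(4) by simp

lemma subspace_over_sum:
  "subspace_over A V \<Longrightarrow> (\<And>i. i \<in> I \<Longrightarrow> f i \<in> V) \<Longrightarrow> sum f I \<in> V"
  by (induction I rule: infinite_finite_induct) (auto intro: subspace_over_closed)

lemma subspace_over_insert:
  assumes A: "subfield A" and V: "subspace_over A V"
  shows "subspace_over A {v + a * y |v a. v \<in> V \<and> a \<in> A}"
proof -
  define U where "U = {v + a * y |v a. v \<in> V \<and> a \<in> A}"
  have mem: "v + a * y \<in> U" if "v \<in> V" "a \<in> A" for v a using that U_def by blast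
  have elim: thesis if "x \<in> U" "\<And>v a. v \<in> V \<Longrightarrow> a \<in> A \<Longrightarrow> x = v + a * y \<Longrightarrow> thesis" for x thesis
    using that U_def by blast
  have "0 \<in> U"
    using mem[OF subspace_over_closed(1)[OF V] subfield_closed(1)[OF A]] by simp
  moreover have "x + z \<in> U" if x: "x \<in> U" and z: "z \<in> U" for x z
  proof (rule elim[OF x], rule elim[OF z])
    fix v a w b assume "v \<in> V" "a \<in> A" "x = v + a * y" "w \<in> V" "b \<in> A" "z = w + b * y"
    then show ?thesis
      using mem[of "v + w" "a + b"] subspace_over_closed(2)[OF V] subfield_closed(3)[OF A]
      by (simp add: algebra_simps)
  qed
  moreover have "c * x \<in> U" if c: "c \<in> A" and x: "x \<in> U" for x c
  proof (rule elim[OF x])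
    fix v a assume "v \<in> V" "a \<in> A" "x = v + a * y"
    then show ?thesis
      using c mem[of "c * v" "c * a"] subspace_over_closed(3)[OF V] subfield_closed(4)[OF A]
      by (simp add: algebra_simps)
  qed
  ultimately show ?thesis unfolding subspace_over_def U_def[symmetric] by simp
qed

lemma subspace_over_lspan: "subfield A \<Longrightarrow> subspace_over A (lspan A xs)"
proof (induction xs)
  case Nil
  then show ?case by (simp add: subspace_over_def)
next
  case (Cons y xs)
  then show ?case using subspace_over_insert by simp
qed

lemma subspace_over_subfield:
  assumes "subfield F" "A \<subseteq> F"
  shows "subspace_over A F"
  using subfield_closed(1,3,4)[OF assms(1)] assms(2) unfolding subspace_over_def by auto

lemma lspan_least:
  "subspace_over A V \<Longrightarrow> set xs \<subseteq> V \<Longrightarrow> lspan A xs \<subseteq> V"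
  by (induction xs) (auto intro: subspace_over_closed)

lemma lspan_Cons_superset:
  assumes "subfield A"
  shows "lspan A xs \<subseteq> lspan A (y # xs)"
proof
  fix v assume "v \<in> lspan A xs"
  then show "v \<in> lspan A (y # xs)"
    using subfield_closed(1)[OF assms] by (simp, intro exI[of _ v] exI[of _ 0]) simp
qed

lemma lspan_member: "subfield A \<Longrightarrow> x \<in> set xs \<Longrightarrow> x \<in> lspan A xs"
proof (induction xs)
  case (Cons y xs)
  show ?case
  proof (cases "x = y")
    case True
    then show ?thesis
      using subfield_closed(2)[OF Cons.prems(1)]
        subspace_over_closed(1)[OF subspace_over_lspan[OF Cons.prems(1), of xs]]
      by (simp, intro exI[of _ 0] exI[of _ 1]) simp
  next
    case False
    then show ?thesis using Cons lspan_Cons_superset[of A xs y] by auto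
  qed
qed simp

lemma lspan_mono: "subfield A \<Longrightarrow> set xs \<subseteq> set ys \<Longrightarrow> lspan A xs \<subseteq> lspan A ys"
  using lspan_least[OF subspace_over_lspan] lspan_member by blast

lemma lspan_base_mono: "A \<subseteq> B \<Longrightarrow> lspan A xs \<subseteq> lspan B xs"
  by (induction xs) auto

text \<open>The spanning vectors may lie outside \<open>V\<close>; for \<open>V = UNIV\<close> the
  inclusion becomes an equality.\<close>

definition finite_over :: "'a::field set \<Rightarrow> 'a set \<Rightarrow> bool" where
  "finite_over A V \<longleftrightarrow> (\<exists>xs. V \<subseteq> lspan A xs)"

text \<open>Products of the elements of the two spanning lists span over \<open>A\<close>, as in the
  tower law for degrees.\<close>

lemma finite_over_trans:
  assumes A: "subfield A" and AM: "finite_over A M" and MF: "finite_over M F"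
  shows "finite_over A F"
proof -
  obtain xs where xs: "M \<subseteq> lspan A xs" using AM unfolding finite_over_def by auto
  obtain ys where ys: "F \<subseteq> lspan M ys" using MF unfolding finite_over_def by auto
  have mult: "m * y \<in> lspan A (map (\<lambda>x. x * y) zs)" if "m \<in> lspan A zs" for m y zs
    using that
  proof (induction zs arbitrary: m)
    case (Cons z zs)
    then obtain v a where "m = v + a * z" "v \<in> lspan A zs" "a \<in> A" by auto
    then show ?case using Cons.IH[of v] by (auto simp: algebra_simps)
  qed simp
  have "\<exists>zs. lspan M ys \<subseteq> lspan A zs"
  proof (induction ys)
    case Nil
    show ?case by (auto intro: exI[of _ "[]"])
  next
    case (Cons y ys)
    then obtain zs where zs: "lspan M ys \<subseteq> lspan A zs" by auto
    let ?w = "zs @ map (\<lambda>x. x * y) xs"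
    have "lspan A zs \<subseteq> lspan A ?w" "lspan A (map (\<lambda>x. x * y) xs) \<subseteq> lspan A ?w"
      by (rule lspan_mono[OF A]; simp)+
    then have "v + m * y \<in> lspan A ?w" if "v \<in> lspan M ys" "m \<in> M" for v m
      using zs mult[of m xs y] xs that by (intro subspace_over_closed(2)[OF subspace_over_lspan[OF A]]) auto
    then have "lspan M (y # ys) \<subseteq> lspan A ?w" by auto
    then show ?case by blast
  qed
  then show ?thesis using ys unfolding finite_over_def by blast
qed

text \<open>The powers are bounded by \<open>q\<close>, so this is a ring only if \<open>s ^ q\<close> lies in \<open>M\<close>.\<close>

definition adjoin :: "nat \<Rightarrow> 'a::field set \<Rightarrow> 'a \<Rightarrow> 'a set" where
  "adjoin q M s = {\<Sum>i<q. a i * s ^ i |a. \<forall>i. a i \<in> M}"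

lemma subspace_over_adjoin:
  assumes M: "subfield M"
  shows "subspace_over M (adjoin q M s)"
proof -
  have mem: "(\<Sum>i<q. a i * s ^ i) \<in> adjoin q M s" if "\<And>i. a i \<in> M" for a
    using that by (auto simp: adjoin_def)
  have "0 \<in> adjoin q M s"
    using mem[of "\<lambda>_. 0"] subfield_closed(1)[OF M] by simp
  moreover have "x + y \<in> adjoin q M s" if xy: "x \<in> adjoin q M s" "y \<in> adjoin q M s" for x y
  proof -
    from xy obtain a b where "x = (\<Sum>i<q. a i * s ^ i)" "\<And>i. a i \<in> M"
      "y = (\<Sum>i<q. b i * s ^ i)" "\<And>i. b i \<in> M"
      unfolding adjoin_def by blast
    then show ?thesis
      using mem[of "\<lambda>i. a i + b i"] subfield_closed(3)[OF M] by (simp add: sum.distrib distrib_right)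
  qed
  moreover have "c * x \<in> adjoin q M s" if c: "c \<in> M" and x: "x \<in> adjoin q M s" for c x
  proof -
    from x obtain a where "x = (\<Sum>i<q. a i * s ^ i)" "\<And>i. a i \<in> M"
      unfolding adjoin_def by blast
    then show ?thesis
      using mem[of "\<lambda>i. c * a i"] c subfield_closed(4)[OF M] by (simp add: sum_distrib_left mult.assoc)
  qed
  ultimately show ?thesis unfolding subspace_over_def by blast
qed

lemma adjoin_mult_generator:
  assumes M: "subfield M" and s: "s ^ q \<in> M" and x: "x \<in> adjoin q M s"
  shows "s * x \<in> adjoin q M s"
proof (cases q)
  case 0
  then show ?thesis using x by (auto simp: adjoin_def)
next
  case (Suc m)
  obtain a where a: "x = (\<Sum>i<q. a i * s ^ i)" "\<And>i. a i \<in> M" using x by (auto simp: adjoin_def)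
  \<comment> \<open>Multiplying by \<open>s\<close> shifts the coefficients up by one; the overflow
    \<open>a m * s ^ q\<close> is an element of \<open>M\<close> and becomes the constant
    term.\<close>
  define b where "b = (\<lambda>i. case i of 0 \<Rightarrow> a m * s ^ q | Suc j \<Rightarrow> a j)"
  have "s * x = (\<Sum>i<m. a i * s ^ Suc i) + a m * s ^ q"
    unfolding a Suc by (simp add: sum_distrib_left algebra_simps)
  also have "\<dots> = (\<Sum>i<q. b i * s ^ i)"
    unfolding Suc sum.lessThan_Suc_shift by (simp add: b_def Suc)
  finally show ?thesis
    unfolding adjoin_def using a(2) s subfield_closed(4)[OF M]
    by (auto simp: b_def intro!: exI[of _ b] split: nat.split)
qed

lemma adjoin_superset: 
  assumes "subfield M" "0 < q" "m \<in> M"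
  shows "m \<in> adjoin q M s"
proof -
  have "m = (\<Sum>i<q. (if i = 0 then m else 0) * s ^ i)"
    using assms(2) by (simp add: if_distrib if_distribR sum.delta cong: if_cong)
  then show ?thesis
    unfolding adjoin_def using assms subfield_closed(1)[OF assms(1)]
    by (auto intro!: exI[of _ "\<lambda>i. if i = 0 then m else 0"])
qed

lemma adjoin_power_mem:
  assumes "subfield M" "s ^ q \<in> M" "0 < q" "m \<in> M"
  shows "m * s ^ k \<in> adjoin q M s"
proof (induction k)
  case 0
  then show ?case using adjoin_superset[OF assms(1,3,4)] by simp
next
  case (Suc k)
  then show ?case
    using adjoin_mult_generator[OF assms(1,2) Suc] by (simp add: mult.left_commute[of s])
qed

lemma adjoin_least:
  assumes "subfield F" "M \<subseteq> F" "s \<in> F"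
  shows "adjoin q M s \<subseteq> F"
proof -
  have "(\<Sum>i<q. a i * s ^ i) \<in> F" if "\<forall>i. a i \<in> M" for a
    using assms that
    by (intro subfield_sum subfield_closed(4)[OF assms(1)] subfield_power) auto
  then show ?thesis unfolding adjoin_def by blast
qed

lemma adjoin_mult:
  assumes M: "subfield M" and s: "s ^ q \<in> M" and x: "x \<in> adjoin q M s" and y: "y \<in> adjoin q M s"
  shows "x * y \<in> adjoin q M s"
proof -
  obtain a where a: "x = (\<Sum>i<q. a i * s ^ i)" "\<And>i. a i \<in> M" using x by (auto simp: adjoin_def)
  have "s ^ i * y \<in> adjoin q M s" for i
    by (induction i) (use y adjoin_mult_generator[OF M s] in \<open>auto simp: mult.assoc\<close>)
  then have "a i * (s ^ i * y) \<in> adjoin q M s" for i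
    using subspace_over_closed(3)[OF subspace_over_adjoin[OF M]] a(2) by blast
  then show ?thesis
    unfolding a(1) sum_distrib_right mult.assoc
    by (intro subspace_over_sum[OF subspace_over_adjoin[OF M]])
qed

lemma finite_over_adjoin:
  assumes M: "subfield M"
  shows "finite_over M (adjoin q M s)"
proof -
  note V = subspace_over_lspan[OF M, of "map (\<lambda>i. s ^ i) [0..<q]"]
  have "(\<Sum>i<q. a i * s ^ i) \<in> lspan M (map (\<lambda>i. s ^ i) [0..<q])" if "\<forall>i. a i \<in> M" for a
    using that by (intro subspace_over_sum[OF V] subspace_over_closed(3)[OF V] lspan_member[OF M]) auto
  then have "adjoin q M s \<subseteq> lspan M (map (\<lambda>i. s ^ i) [0..<q])"
    unfolding adjoin_def by blast
  then show ?thesis unfolding finite_over_def by blast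
qed

section \<open>Frobenius and finiteness over the fields of \<open>p^n\<close>-th powers\<close>

context
  assumes char_pos: "CHAR('a::field) > 0"
begin

lemma prime_char: "prime CHAR('a)"
  using prime_CHAR_semidom char_pos by blast

lemma frobenius_add: "(x + y :: 'a) ^ (CHAR('a) ^ n) = x ^ (CHAR('a) ^ n) + y ^ (CHAR('a) ^ n)"
  by (rule freshmans_dream'[OF prime_char refl])

lemma frobenius_sum: "sum f I ^ (CHAR('a) ^ n) = (\<Sum>i\<in>I. (f i :: 'a) ^ (CHAR('a) ^ n))"
  by (rule freshmans_dream_sum'[OF prime_char refl])

lemma frobenius_uminus: "(- x :: 'a) ^ (CHAR('a) ^ n) = - (x ^ (CHAR('a) ^ n))"
proof -
  have "(- x) ^ (CHAR('a) ^ n) + x ^ (CHAR('a) ^ n) = 0"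
    using frobenius_add[of "-x" x n] char_pos by (simp add: power_0_left)
  then show ?thesis by (simp add: add_eq_0_iff)
qed

lemma subfield_ppow_field: "subfield (ppow_field n :: 'a set)"
proof -
  have mem: "x ^ (CHAR('a) ^ n) \<in> ppow_field n" for x :: 'a by (simp add: ppow_field_def)
  show ?thesis
    unfolding subfield_def
    using mem[of 0] mem[of 1] mem[of "_ + _"] mem[of "_ * _"] mem[of "- _"] mem[of "inverse _"] char_pos
    by (auto simp: frobenius_add frobenius_uminus power_mult_distrib power_inverse power_0_left
        ppow_field_def)
qed

text \<open>Inverses come from Frobenius: with \<open>q = p^n\<close>, the power
  \<open>x ^ q\<close> of every element \<open>x\<close> lies in \<open>M\<close>, so
  \<open>inverse x\<close> is \<open>x ^ (q - 1)\<close> divided by an element of \<open>M\<close>.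
  The degree of \<open>s\<close> over \<open>M\<close> never enters.\<close>

lemma subfield_adjoin:
  fixes M :: "'a set"
  assumes M: "subfield M" and s: "s ^ (CHAR('a) ^ n) \<in> M"
  shows "subfield (adjoin (CHAR('a) ^ n) M s)" (is "subfield ?N")
proof -
  have q: "0 < CHAR('a) ^ n" using char_pos by simp
  note V = subspace_over_closed[OF subspace_over_adjoin[OF M]]
  have pow: "x ^ (CHAR('a) ^ n) \<in> M" if x: "x \<in> ?N" for x
  proof -
    obtain a where a: "x = (\<Sum>i<CHAR('a) ^ n. a i * s ^ i)" "\<And>i. a i \<in> M"
      using x unfolding adjoin_def by blast
    have "x ^ (CHAR('a) ^ n) = (\<Sum>i<CHAR('a) ^ n. a i ^ (CHAR('a) ^ n) * (s ^ (CHAR('a) ^ n)) ^ i)"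
      unfolding a(1) frobenius_sum by (simp add: power_mult_distrib power_mult[symmetric] mult.commute)
    then show ?thesis
      using a(2) s M by (auto intro!: subfield_sum subfield_closed(4)[OF M] subfield_power)
  qed
  have inv: "inverse x \<in> ?N" if "x \<in> ?N" for x
  proof (cases "x = 0")
    case True
    then show ?thesis using that by simp
  next
    case False
    have "x ^ k \<in> ?N" for k
      by (induction k) (use that adjoin_mult[OF M s] adjoin_superset[OF M q subfield_closed(2)[OF M]] in auto)
    then have "inverse (x ^ (CHAR('a) ^ n)) * x ^ (CHAR('a) ^ n - 1) \<in> ?N"
      using V(3) subfield_closed(6)[OF M pow[OF that]] by blast
    moreover have "x ^ (CHAR('a) ^ n) = x * x ^ (CHAR('a) ^ n - 1)"
      using q by (metis power_eq_if neq0_conv)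
    then have "inverse (x ^ (CHAR('a) ^ n)) * x ^ (CHAR('a) ^ n - 1) = inverse x"
      using False by (simp add: field_simps)
    ultimately show ?thesis by simp
  qed
  have "- x \<in> ?N" if "x \<in> ?N" for x
    using V(3)[OF subfield_closed(5)[OF M subfield_closed(2)[OF M]] that] by simp
  then show ?thesis
    unfolding subfield_def
    using V(1,2) adjoin_superset[OF M q subfield_closed(2)[OF M]] inv adjoin_mult[OF M s] by simp
qed

lemma adjoin_generator_mem:
  assumes "subfield (M :: 'a set)" "s ^ (CHAR('a) ^ n) \<in> M"
  shows "s \<in> adjoin (CHAR('a) ^ n) M s"
  using adjoin_power_mem[OF assms, of 1 1] char_pos subfield_closed(2)[OF assms(1)] by simp

text \<open>Generators are adjoined one at a time; each stage is a field spanned by finitely many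
  powers over the previous one, and transitivity accumulates the finiteness.\<close>

lemma finite_over_generated:
  fixes A :: "'a set"
  assumes A: "subfield A" and S: "finite S" "\<And>s. s \<in> S \<Longrightarrow> s ^ (CHAR('a) ^ n) \<in> A"
  shows "finite_over A (gen_field (A \<union> S))"
proof -
  have "\<exists>M. subfield M \<and> A \<union> S \<subseteq> M \<and> finite_over A M"
    using S
  proof (induction S rule: finite_induct)
    case empty
    have "A \<subseteq> lspan A [1]" by auto
    then show ?case using A unfolding finite_over_def by (intro exI[of _ A]) blast
  next
    case (insert s S)
    then obtain M where M: "subfield M" "A \<union> S \<subseteq> M" "finite_over A M" by auto
    let ?N = "adjoin (CHAR('a) ^ n) M s"
    have s: "s ^ (CHAR('a) ^ n) \<in> M" using insert M by auto
    have "M \<subseteq> ?N" "s \<in> ?N"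
      using adjoin_superset[OF M(1)] adjoin_generator_mem[OF M(1) s] char_pos by auto
    then have "A \<union> insert s S \<subseteq> ?N" using M(2) by auto
    then show ?case
      using subfield_adjoin[OF M(1) s] finite_over_trans[OF A M(3) finite_over_adjoin[OF M(1)]]
      by (intro exI[of _ ?N] conjI)
  qed
  then obtain M where "subfield M" "A \<union> S \<subseteq> M" "finite_over A M" by auto
  then show ?thesis using gen_field_least[of M "A \<union> S"] unfolding finite_over_def by blast
qed

text \<open>The perfect core lies in \<open>ppow_field n\<close>, so generators over the core also
  generate over \<open>ppow_field n\<close>, where their \<open>p^n\<close>-th powers already
  lie.\<close>

lemma finite_over_ppow_field:
  assumes "fin_gen_over (perfect_core :: 'a set)"
  shows "finite_over (ppow_field n) (UNIV :: 'a set)"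
proof -
  obtain S :: "'a set" where S: "finite S" "gen_field (perfect_core \<union> S) = UNIV"
    using assms unfolding fin_gen_over_def by auto
  have "gen_field (ppow_field n \<union> S) = UNIV"
    using S(2) gen_field_mono[of "perfect_core \<union> S" "ppow_field n \<union> S"] perfect_core_subset by auto
  then show ?thesis
    using finite_over_generated[OF subfield_ppow_field S(1), of n n] by (auto simp: ppow_field_def)
qed

end

section \<open>Differential operators as linear operators\<close>

definition lin_op :: "'a::field set \<Rightarrow> ('a \<Rightarrow> 'a) \<Rightarrow> bool" where
  "lin_op A D \<longleftrightarrow> (\<forall>x y. D (x + y) = D x + D y) \<and> (\<forall>a\<in>A. \<forall>x. D (a * x) = a * D x)"

lemma lin_opD:
  assumes "lin_op A D"
  shows "D (x + y) = D x + D y" "a \<in> A \<Longrightarrow> D (a * x) = a * D x" "D 0 = 0" "D (x - y) = D x - D y"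
proof -
  show add: "D (x + y) = D x + D y" for x y using assms by (simp add: lin_op_def)
  show "a \<in> A \<Longrightarrow> D (a * x) = a * D x" using assms by (simp add: lin_op_def)
  show "D 0 = 0" using add[of 0 0] by (metis add_0 add_cancel_right_right)
  show "D (x - y) = D x - D y" using add[of "x - y" y] by simp
qed

lemma lin_op_antimono: "A \<subseteq> B \<Longrightarrow> lin_op B D \<Longrightarrow> lin_op A D"
  by (auto simp: lin_op_def)

section \<open>Iterated commutators with multiplications\<close>

lemma ad_op_zero [simp]: "ad_op b (\<lambda>x. 0) = (\<lambda>x. 0)"
  by (simp add: ad_op_def)

lemma nested_zero_zero: "nested_zero n (\<lambda>x. 0)"
  by (induction n) auto

lemma nested_zero_add:
  "nested_zero n D \<Longrightarrow> nested_zero n E \<Longrightarrow> nested_zero n (\<lambda>x. D x + E x)"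
proof (induction n arbitrary: D E)
  case 0
  then show ?case by (auto simp: ad_op_def fun_eq_iff algebra_simps)
next
  case (Suc n)
  have "ad_op b (\<lambda>x. D x + E x) = (\<lambda>x. ad_op b D x + ad_op b E x)" for b
    by (auto simp: ad_op_def fun_eq_iff algebra_simps)
  then show ?case using Suc by simp
qed

lemma nested_zero_scale: "nested_zero n D \<Longrightarrow> nested_zero n (\<lambda>x. c * D x)"
proof (induction n arbitrary: D)
  case 0
  then show ?case by (auto simp: ad_op_def fun_eq_iff algebra_simps)
next
  case (Suc n)
  have "ad_op b (\<lambda>x. c * D x) = (\<lambda>x. c * ad_op b D x)" for b
    by (auto simp: ad_op_def fun_eq_iff algebra_simps)
  then show ?case using Suc by simp
qed

lemma lin_op_ad_op:
  assumes "lin_op A D"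
  shows "lin_op A (ad_op b D)"
  using lin_opD(1,2)[OF assms] by (simp add: lin_op_def ad_op_def algebra_simps mult.left_commute)

lemma ad_op_commute: "ad_op a (ad_op b D) = ad_op b (ad_op a D)"
  by (auto simp: ad_op_def fun_eq_iff algebra_simps)

lemma ad_op_funpow_commute: "(ad_op a ^^ n) (ad_op b D) = ad_op b ((ad_op a ^^ n) D)"
  by (induction n) (auto simp: ad_op_commute)

lemma ad_op_funpow_zero: "(ad_op b ^^ n) (\<lambda>x. 0) = (\<lambda>x. 0)"
  by (induction n) auto

text \<open>Linearity of \<open>D\<close> over \<open>A\<close> makes \<open>ad_op x D\<close>
  additive and \<open>A\<close>-linear in \<open>x\<close>, so a bound on the order passes from a
  list to its span.\<close>

lemma ad_op_lspan:
  assumes "lin_op A D" "x \<in> lspan A ys" "\<And>y. y \<in> set ys \<Longrightarrow> nested_zero n (ad_op y D)"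
  shows "nested_zero n (ad_op x D)"
  using assms(2,3)
proof (induction ys arbitrary: x)
  case Nil
  then have "ad_op x D = (\<lambda>x. 0)" using lin_opD(3)[OF assms(1)] by (simp add: ad_op_def)
  then show ?case by (simp add: nested_zero_zero)
next
  case (Cons y ys)
  then obtain v a where x: "x = v + a * y" "v \<in> lspan A ys" "a \<in> A" by auto
  have "ad_op x D = (\<lambda>z. ad_op v D z + a * ad_op y D z)"
    unfolding x(1) ad_op_def using lin_opD(1,2)[OF assms(1)] x(3)
    by (auto simp: fun_eq_iff distrib_right right_diff_distrib mult.assoc)
  then show ?case using Cons.IH[OF x(2)] Cons.prems(2) by (simp add: nested_zero_add nested_zero_scale)
qed

text \<open>Over a finite spanning set the operator is killed by a power of each \<open>ad_op b\<close>; every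
  further commutator lowers one of the exponents \<open>e b\<close>.\<close>

lemma nested_zero_of_nilpotent:
  assumes span: "lspan A xs = UNIV" and D: "lin_op A D"
    and e: "\<And>b. b \<in> set xs \<Longrightarrow> (ad_op b ^^ e b) D = (\<lambda>x. 0)" and n: "(\<Sum>b\<in>set xs. e b) \<le> n"
  shows "nested_zero n D"
  using D e n
proof (induction n arbitrary: D e)
  case 0
  \<comment> \<open>An empty list would make the bound on the exponents vacuous; it is excluded
    because 1 is not in the zero space.\<close>
  have "xs \<noteq> []"
  proof
    assume "xs = []"
    then have "(1 :: 'a) \<in> {0}" using span by simp
    then show False by simp
  qed
  then obtain b where "b \<in> set xs" by (cases xs) auto
  then have "D = (\<lambda>x. 0)" using 0 by (metis finite_set funpow_0 le_zero_eq sum_eq_0_iff)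
  then show ?case by (simp add: nested_zero_zero)
next
  case (Suc n)
  show ?case
  proof (cases "\<exists>b\<in>set xs. e b = 0")
    case True
    then have "D = (\<lambda>x. 0)" using Suc.prems(2) by fastforce
    then show ?thesis by (simp only: nested_zero_zero)
  next
    case False
    have "nested_zero n (ad_op b D)" if b: "b \<in> set xs" for b
    proof (rule Suc.IH[where e = "e(b := e b - 1)"])
      show "lin_op A (ad_op b D)" using Suc.prems lin_op_ad_op by blast
      have eb: "e b > 0" using False b by auto
      show "(ad_op c ^^ (e(b := e b - 1)) c) (ad_op b D) = (\<lambda>x. 0)" if c: "c \<in> set xs" for c
      proof (cases "c = b")
        case True
        have "(ad_op b ^^ (e b - 1)) (ad_op b D) = (ad_op b ^^ e b) D"
          using eb by (metis Suc_pred' comp_apply funpow_Suc_right)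
        then show ?thesis using True Suc.prems(2)[OF b] by simp
      next
        case False
        then show ?thesis using Suc.prems(2)[OF c] by (simp add: ad_op_funpow_commute)
      qed
      have "sum (e(b := e b - 1)) (set xs) = (e b - 1) + sum e (set xs - {b})"
        using b by (simp add: sum.remove)
      moreover have "sum e (set xs) = e b + sum e (set xs - {b})"
        using b by (simp add: sum.remove)
      ultimately show "sum (e(b := e b - 1)) (set xs) \<le> n" using Suc.prems(3) eb by simp
    qed
    then have "nested_zero n (ad_op x D)" for x
      using ad_op_lspan[OF Suc.prems(1), of x xs n] span by simp
    then show ?thesis by simp
  qed
qed

text \<open>Pascal's rule summed against arbitrary weights; it drives the induction both for
  iterated commutators and for the iterated Leibniz rule.\<close>

lemma sum_pascal:
  fixes t :: "nat \<Rightarrow> 'a::comm_semiring_1"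
  shows "(\<Sum>k\<le>Suc n. of_nat (Suc n choose k) * t k)
    = (\<Sum>k\<le>n. of_nat (n choose k) * t k) + (\<Sum>k\<le>n. of_nat (n choose k) * t (Suc k))"
proof -
  have "(\<Sum>k\<le>Suc n. of_nat (Suc n choose k) * t k)
      = t 0 + (\<Sum>k\<le>n. of_nat (n choose Suc k) * t (Suc k)) + (\<Sum>k\<le>n. of_nat (n choose k) * t (Suc k))"
    unfolding sum.atMost_Suc_shift by (simp add: distrib_right sum.distrib add_ac)
  also have "t 0 + (\<Sum>k\<le>n. of_nat (n choose Suc k) * t (Suc k)) = (\<Sum>k\<le>Suc n. of_nat (n choose k) * t k)"
    unfolding sum.atMost_Suc_shift by simp
  also have "\<dots> = (\<Sum>k\<le>n. of_nat (n choose k) * t k)"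
    by (simp add: binomial_eq_0)
  finally show ?thesis .
qed

text \<open>\<open>ad_op b\<close> is the difference of two commuting maps, multiplication by
  \<open>b\<close> after and before the operator, so the binomial theorem applies.\<close>

lemma ad_op_funpow_apply:
  "(ad_op b ^^ n) D x = (\<Sum>k\<le>n. of_nat (n choose k) * (-1) ^ k * b ^ (n - k) * D (b ^ k * x))"
proof (induction n arbitrary: x)
  case 0
  show ?case by simp
next
  case (Suc n)
  let ?t = "\<lambda>k. (-1) ^ k * b ^ (Suc n - k) * D (b ^ k * x)"
  have 1: "b * (ad_op b ^^ n) D x = (\<Sum>k\<le>n. of_nat (n choose k) * ?t k)"
    unfolding Suc sum_distrib_left by (intro sum.cong) (auto simp: Suc_diff_le algebra_simps)
  have 2: "- (ad_op b ^^ n) D (b * x) = (\<Sum>k\<le>n. of_nat (n choose k) * ?t (Suc k))"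
    unfolding Suc sum_negf[symmetric] by (intro sum.cong) (auto simp: algebra_simps)
  note 3 = sum_pascal[of n ?t]
  have "(ad_op b ^^ Suc n) D x = b * (ad_op b ^^ n) D x + - (ad_op b ^^ n) D (b * x)"
    by (simp add: ad_op_def[of b "(ad_op b ^^ n) D"])
  also have "\<dots> = (\<Sum>k\<le>Suc n. of_nat (Suc n choose k) * ?t k)"
    unfolding 1 2 3 ..
  finally show ?case by (simp only: mult.assoc)
qed

lemma nested_zero_imp_ad_op_funpow: "nested_zero n D \<Longrightarrow> (ad_op b ^^ Suc n) D = (\<lambda>x. 0)"
proof (induction n arbitrary: D)
  case (Suc n)
  then have "(ad_op b ^^ Suc n) (ad_op b D) = (\<lambda>x. 0)" by simp
  then show ?case by (metis comp_apply funpow_Suc_right)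
qed simp

context
  assumes char_pos: "CHAR('a::field) > 0"
begin

lemma ad_op_funpow_char: "(ad_op (b :: 'a) ^^ CHAR('a)) D = ad_op (b ^ CHAR('a)) D"
proof
  fix x
  let ?p = "CHAR('a)"
  let ?f = "\<lambda>k. of_nat (?p choose k) * (-1) ^ k * b ^ (?p - k) * D (b ^ k * x)"
  have "(ad_op b ^^ ?p) D x = sum ?f {..?p}" by (rule ad_op_funpow_apply)
  also have "\<dots> = sum ?f {0, ?p}"
  proof (rule sum.mono_neutral_right)
    show "\<forall>k\<in>{..?p} - {0, ?p}. ?f k = 0"
    proof
      fix k assume "k \<in> {..?p} - {0, ?p}"
      then have "?p dvd (?p choose k)"
        using prime_char[OF char_pos] by (intro dvd_choose_prime) auto
      then have "of_nat (?p choose k) = (0 :: 'a)" using of_nat_eq_0_iff_char_dvd by blast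
      then show "?f k = 0" by simp
    qed
  qed auto
  also have "\<dots> = b ^ ?p * D x + (-1) ^ ?p * D (b ^ ?p * x)"
    using char_pos by simp
  \<comment> \<open>Additivity of Frobenius gives the sign uniformly, including characteristic
    two.\<close>
  also have "(-1 :: 'a) ^ ?p = -1"
    using frobenius_uminus[OF char_pos, of 1 1] by simp
  finally show "(ad_op b ^^ ?p) D x = ad_op (b ^ ?p) D x"
    by (simp add: ad_op_def[of "b ^ ?p"])
qed

lemma ad_op_funpow_char_power: "(ad_op (b :: 'a) ^^ (CHAR('a) ^ m)) D = ad_op (b ^ (CHAR('a) ^ m)) D"
proof (induction m arbitrary: D)
  case (Suc m)
  have "ad_op b ^^ (CHAR('a) ^ m) = ad_op (b ^ (CHAR('a) ^ m))" using Suc by blast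
  then have "ad_op b ^^ (CHAR('a) ^ m * CHAR('a)) = ad_op (b ^ (CHAR('a) ^ m)) ^^ CHAR('a)"
    by (metis funpow_mult mult.commute)
  then show ?case using ad_op_funpow_char by (simp add: power_mult[symmetric] mult.commute)
qed simp

text \<open>For \<open>a = b ^ (p^m)\<close> the commutator with \<open>a\<close> is the
  \<open>p^m\<close>-fold commutator with \<open>b\<close>. The predicate
  \<open>nested_zero n\<close> annihilates \<open>n + 1\<close> commutators, and
  \<open>n < m < p^m\<close> provides that many.\<close>

lemma nested_zero_commutes:
  assumes "nested_zero n (D :: 'a \<Rightarrow> 'a)" "n < m" "a \<in> ppow_field m"
  shows "D (a * x) = a * D x"
proof -
  obtain b where b: "a = b ^ (CHAR('a) ^ m)" using assms(3) by (auto simp: ppow_field_def)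
  have "m < CHAR('a) ^ m"
    using prime_gt_1_nat[OF prime_char[OF char_pos]] by (simp add: power_gt_expt)
  then obtain k where k: "CHAR('a) ^ m = k + Suc n"
    using assms(2) by (metis add.commute less_trans less_iff_Suc_add add_Suc_right)
  have "(ad_op b ^^ (k + Suc n)) D = (\<lambda>x. 0)"
    unfolding funpow_add comp_apply nested_zero_imp_ad_op_funpow[OF assms(1)] by (rule ad_op_funpow_zero)
  then have "(ad_op b ^^ (CHAR('a) ^ m)) D = (\<lambda>x. 0)" unfolding k .
  then have "ad_op a D x = 0"
    unfolding b ad_op_funpow_char_power by (rule fun_cong)
  then show ?thesis by (simp add: ad_op_def)
qed

lemma Diff_perfect_core_imp_lin_op:
  assumes "D \<in> Diff (perfect_core :: 'a set)"
  shows "\<exists>n. lin_op (ppow_field n) D"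
proof -
  obtain n where n: "nested_zero n D" using assms by (auto simp: Diff_def)
  have "lin_op (ppow_field (Suc n)) D"
    using assms nested_zero_commutes[OF n lessI] by (auto simp: Diff_def lin_op_def)
  then show ?thesis by blast
qed

lemma Diff_eq_lin_op:
  fixes A :: "'a set"
  assumes A: "subfield A" "ppow_field n \<subseteq> A" and fin: "finite_over A (UNIV :: 'a set)"
  shows "Diff A = {D. lin_op A D}"
proof -
  obtain xs where xs: "lspan A xs = UNIV" using fin unfolding finite_over_def by auto
  have "\<exists>n. nested_zero n D" if D: "lin_op A D" for D
  proof -
    have "b ^ (CHAR('a) ^ n) \<in> A" for b using A(2) by (auto simp: ppow_field_def)
    then have "(ad_op b ^^ (CHAR('a) ^ n)) D = (\<lambda>x. 0)" for b
      unfolding ad_op_funpow_char_power using lin_opD(2)[OF D] by (simp add: ad_op_def)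
    then show ?thesis
      using nested_zero_of_nilpotent[OF xs D, of "\<lambda>_. CHAR('a) ^ n"] by blast
  qed
  then show ?thesis unfolding Diff_def lin_op_def by blast
qed

end

section \<open>Extension of linear maps\<close>

definition lin_on :: "'a::field set \<Rightarrow> 'a set \<Rightarrow> ('a \<Rightarrow> 'a) \<Rightarrow> bool" where
  "lin_on A V f \<longleftrightarrow> (\<forall>x\<in>V. \<forall>y\<in>V. f (x + y) = f x + f y) \<and> (\<forall>a\<in>A. \<forall>x\<in>V. f (a * x) = a * f x)"

text \<open>A vector outside \<open>V\<close> has a unique coefficient in each element of the
  enlarged space, so its image \<open>u\<close> can be prescribed freely.\<close>

lemma lin_on_extend_step:
  assumes A: "subfield A" and V: "subspace_over A V" and f: "lin_on A V f" and y: "y \<notin> V"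
  shows "\<exists>g. lin_on A {v + a * y |v a. v \<in> V \<and> a \<in> A} g \<and> (\<forall>v\<in>V. \<forall>a\<in>A. g (v + a * y) = f v + a * u)"
proof -
  have uniq: "v = w \<and> a = b" if "v \<in> V" "w \<in> V" "a \<in> A" "b \<in> A" "v + a * y = w + b * y" for v w a b
  proof (cases "a = b")
    case False
    have "(a - b) * y = w - v" using that(5) by (simp add: algebra_simps)
    then have "y = inverse (a - b) * (w - v)" using False by (simp add: field_simps)
    then have "y \<in> V"
      using subspace_over_closed(3)[OF V] subspace_over_minus[OF A V that(2,1)]
        subfield_closed(6,7)[OF A] that(3,4) by blast
    then show ?thesis using y by simp
  qed (use that in simp)
  \<comment> \<open>The coordinates of \<open>z\<close> are picked by choice; \<open>uniq\<close>
    identifies the pick on the enlarged space.\<close>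
  define g where "g z = (let va = (SOME va. fst va \<in> V \<and> snd va \<in> A \<and> z = fst va + snd va * y)
      in f (fst va) + snd va * u)" for z
  have g: "g (v + a * y) = f v + a * u" if "v \<in> V" "a \<in> A" for v a
  proof -
    let ?P = "\<lambda>va. fst va \<in> V \<and> snd va \<in> A \<and> v + a * y = fst va + snd va * y"
    have "?P (v, a)" using that by simp
    then have "?P (Eps ?P)" by (rule someI)
    then have "v = fst (Eps ?P) \<and> a = snd (Eps ?P)" using that by (intro uniq) auto
    then show ?thesis unfolding g_def Let_def by simp
  qed
  have "g (v + a * y + (w + b * y)) = g (v + a * y) + g (w + b * y)"
    if "v \<in> V" "w \<in> V" "a \<in> A" "b \<in> A" for v w a b
  proof -
    have "g (v + a * y + (w + b * y)) = g ((v + w) + (a + b) * y)" by (simp add: algebra_simps)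
    also have "\<dots> = f (v + w) + (a + b) * u"
      using that subspace_over_closed(2)[OF V] subfield_closed(3)[OF A] by (intro g) auto
    finally show ?thesis using g that f by (simp add: lin_on_def algebra_simps)
  qed
  moreover have "g (c * (v + a * y)) = c * g (v + a * y)" if "v \<in> V" "a \<in> A" "c \<in> A" for v a c
  proof -
    have "g (c * (v + a * y)) = g (c * v + (c * a) * y)" by (simp add: algebra_simps)
    also have "\<dots> = f (c * v) + (c * a) * u"
      using that subspace_over_closed(3)[OF V] subfield_closed(4)[OF A] by (intro g) auto
    finally show ?thesis using g that f by (simp add: lin_on_def algebra_simps)
  qed
  ultimately have "lin_on A {v + a * y |v a. v \<in> V \<and> a \<in> A} g" unfolding lin_on_def by auto
  then show ?thesis using g by blast
qed

lemma lin_on_extend: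
  assumes A: "subfield A" and V: "subspace_over A V" and f: "lin_on A V f" and fin: "finite_over A UNIV"
  shows "\<exists>g. lin_op A g \<and> (\<forall>v\<in>V. g v = f v)"
proof -
  obtain xs where xs: "lspan A xs = UNIV" using fin unfolding finite_over_def by auto
  have "\<exists>U g. subspace_over A U \<and> V \<subseteq> U \<and> set xs \<subseteq> U \<and> lin_on A U g \<and> (\<forall>v\<in>V. g v = f v)"
  proof (induction xs)
    case Nil
    then show ?case using V f by auto
  next
    case (Cons y xs)
    then obtain U g where U: "subspace_over A U" "V \<subseteq> U" "set xs \<subseteq> U" "lin_on A U g" "\<forall>v\<in>V. g v = f v"
      by auto
    show ?case
    proof (cases "y \<in> U")
      case True
      then show ?thesis using U by auto
    next
      case False
      let ?U = "{v + a * y |v a. v \<in> U \<and> a \<in> A}"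
      \<comment> \<open>The value 0 at the new vector is an arbitrary choice.\<close>
      obtain h where h: "lin_on A ?U h" "\<forall>v\<in>U. \<forall>a\<in>A. h (v + a * y) = g v + a * 0"
        using lin_on_extend_step[OF A U(1,4) False, of 0] by blast
      have mem: "v + 0 * y \<in> ?U" if "v \<in> U" for v using that subfield_closed(1)[OF A] by blast
      have "0 + 1 * y \<in> ?U" using subspace_over_closed(1)[OF U(1)] subfield_closed(2)[OF A] by blast
      then have "U \<subseteq> ?U" "y \<in> ?U" using mem by simp_all (metis (no_types, lifting) add_0_right mem mult_zero_left subsetI)
      moreover have "h v = f v" if "v \<in> V" for v
        using h(2)[rule_format, of v 0] U(2,5) that subfield_closed(1)[OF A] by auto
      ultimately show ?thesis
        using h(1) subspace_over_insert[OF A U(1)] U(2,3) by (intro exI[of _ ?U] exI[of _ h]) auto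
    qed
  qed
  then obtain U g where U: "subspace_over A U" "set xs \<subseteq> U" "lin_on A U g" "\<forall>v\<in>V. g v = f v" by auto
  then have "U = UNIV" using lspan_least[OF U(1,2)] xs by auto
  then show ?thesis using U unfolding lin_on_def lin_op_def by auto
qed

text \<open>Outside \<open>A\<close>, the element \<open>x\<close> is independent of 1 over
  \<open>A\<close>; the zero map on \<open>A\<close> extends with value 1 at \<open>x\<close>, first
  to the span of both and then to the whole field.\<close>

lemma ex_lin_op_separating:
  assumes A: "subfield A" and fin: "finite_over A UNIV" and x: "x \<notin> A"
  shows "\<exists>E. lin_op A E \<and> E 1 = 0 \<and> E x = 1"
proof -
  have V: "subspace_over A A" using subspace_over_subfield[OF A] by simp
  have "lin_on A A (\<lambda>_. 0)" by (simp add: lin_on_def)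
  then obtain g where g: "lin_on A {v + a * x |v a. v \<in> A \<and> a \<in> A} g"
      "\<forall>v\<in>A. \<forall>a\<in>A. g (v + a * x) = 0 + a * 1"
    using lin_on_extend_step[OF A V _ x, of "\<lambda>_. 0" 1] by blast
  let ?U = "{v + a * x |v a. v \<in> A \<and> a \<in> A}"
  obtain E where E: "lin_op A E" "\<forall>v\<in>?U. E v = g v"
    using lin_on_extend[OF A subspace_over_insert[OF A V] g(1) fin] by blast
  have "E (v + a * x) = a" if "v \<in> A" "a \<in> A" for v a
  proof -
    have "v + a * x \<in> ?U" using that by blast
    then show ?thesis using E(2) g(2) that by simp
  qed
  from this[of 1 0] this[of 0 1] show ?thesis
    using E(1) subfield_closed(1,2)[OF A] by auto
qed

text \<open>If \<open>x\<close> is not in \<open>A\<close>, an operator with \<open>E 1 = 0\<close>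
  and \<open>E x = 1\<close> fails to commute with multiplication by \<open>x\<close> at the
  argument 1.\<close>

lemma centralizer_lin_op:
  assumes A: "subfield A" and fin: "finite_over A UNIV"
  shows "{x. \<forall>E. lin_op A E \<longrightarrow> (\<forall>y. x * E y = E (x * y))} = A"
proof -
  have "x \<in> A" if x: "\<forall>E. lin_op A E \<longrightarrow> (\<forall>y. x * E y = E (x * y))" for x
  proof (rule ccontr)
    assume "x \<notin> A"
    then obtain E where "lin_op A E" "E 1 = 0" "E x = 1"
      using ex_lin_op_separating[OF A fin] by blast
    then show False using x[rule_format, of E 1] by simp
  qed
  then show ?thesis using lin_opD(2) by fastforce
qed

section \<open>The Jacobson--Bourbaki correspondence\<close>

text \<open>The setting of the density argument: a ring of additive maps containing all
  multiplications. Scaling by a field element is composition with a multiplication.\<close>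

definition op_algebra :: "('a::field \<Rightarrow> 'a) set \<Rightarrow> bool" where
  "op_algebra B \<longleftrightarrow> (\<forall>c. (\<lambda>x. c * x) \<in> B) \<and> (\<forall>D\<in>B. \<forall>x y. D (x + y) = D x + D y) \<and>
     (\<forall>D\<in>B. \<forall>E\<in>B. (\<lambda>x. D x + E x) \<in> B) \<and> (\<forall>D\<in>B. \<forall>E\<in>B. D \<circ> E \<in> B)"

definition centralizer :: "('a::field \<Rightarrow> 'a) set \<Rightarrow> 'a set" where
  "centralizer B = {x. \<forall>E\<in>B. \<forall>y. x * E y = E (x * y)}"

lemma op_algebraD:
  assumes "op_algebra B"
  shows "(\<lambda>x. c * x) \<in> B" "D \<in> B \<Longrightarrow> D (x + y) = D x + D y"
    "D \<in> B \<Longrightarrow> E \<in> B \<Longrightarrow> (\<lambda>x. D x + E x) \<in> B" "D \<in> B \<Longrightarrow> E \<in> B \<Longrightarrow> (\<lambda>x. D (E x)) \<in> B"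
    "D \<in> B \<Longrightarrow> (\<lambda>x. c * D x) \<in> B"
proof -
  show comp: "D \<in> B \<Longrightarrow> E \<in> B \<Longrightarrow> (\<lambda>x. D (E x)) \<in> B" for D E
    using assms unfolding op_algebra_def comp_def by blast
  show mult: "(\<lambda>x. c * x) \<in> B" for c using assms unfolding op_algebra_def by blast
  show "D \<in> B \<Longrightarrow> (\<lambda>x. c * D x) \<in> B" using comp[OF mult, of D c] by simp
qed (use assms in \<open>auto simp: op_algebra_def\<close>)

lemma lin_op_centralizer: "op_algebra B \<Longrightarrow> D \<in> B \<Longrightarrow> lin_op (centralizer B) D"
  by (simp add: lin_op_def centralizer_def op_algebraD(2))

lemma subfield_centralizer:
  assumes "op_algebra B"
  shows "subfield (centralizer B)"
proof -
  have zero: "E 0 = 0" if "E \<in> B" for E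
    using op_algebraD(2)[OF assms that, of 0 0] by (metis add_0 add_cancel_right_right)
  have neg: "E (- x) = - E x" if "E \<in> B" for E x
    using op_algebraD(2)[OF assms that, of x "-x"] zero[OF that] by (simp add: eq_neg_iff_add_eq_0 add.commute)
  have "inverse x * E y = E (inverse x * y)" if "E \<in> B" "x \<noteq> 0" "\<And>y. x * E y = E (x * y)" for E x y
    using that(3)[of "inverse x * y"] that(2) by (simp add: field_simps)
  then have "inverse x * E y = E (inverse x * y)" if "E \<in> B" "\<And>y. x * E y = E (x * y)" for E x y
    using that zero by (cases "x = 0") auto
  then show ?thesis
    unfolding subfield_def centralizer_def mem_Collect_eq
    using op_algebraD(2)[OF assms] zero neg
    by (simp add: distrib_right mult.assoc del: inverse_eq_divide)
qed

text \<open>An operator \<open>F\<close> normalised to \<open>F y = 1\<close> makes \<open>F x\<close> an element of the centralizer unless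
  some operator killing the span and \<open>y\<close> does not kill \<open>x\<close>.\<close>

lemma op_algebra_separating:
  assumes B: "op_algebra B" and x: "x \<notin> lspan (centralizer B) xs"
  shows "\<exists>E\<in>B. (\<forall>z\<in>lspan (centralizer B) xs. E z = 0) \<and> E x = 1"
  using x
proof (induction xs arbitrary: x)
  \<comment> \<open>The span of the empty list is zero, so \<open>x\<close> is nonzero and
    multiplication by its inverse serves.\<close>
  case Nil
  then show ?case using op_algebraD(1)[OF B, of "inverse x"] by (intro bexI[of _ "\<lambda>z. inverse x * z"]) auto
next
  case (Cons y xs)
  let ?W = "centralizer B"
  note W = subfield_centralizer[OF B]
  note V = subspace_over_lspan[OF W, of xs]
  show ?case
  proof (cases "y \<in> lspan ?W xs")
    case True
    then have "lspan ?W (y # xs) = lspan ?W xs"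
      using lspan_least[OF V, of "y # xs"] lspan_member[OF W, of _ xs] lspan_Cons_superset[OF W, of xs y]
      by (intro equalityI) auto
    then show ?thesis using Cons by simp
  next
    case False
    then obtain F where F: "F \<in> B" "\<forall>z\<in>lspan ?W xs. F z = 0" "F y = 1" using Cons.IH by blast
    show ?thesis
    proof (rule ccontr)
      assume no: "\<not> ?thesis"
      \<comment> \<open>Otherwise \<open>E\<close> minus \<open>E y\<close> times \<open>F\<close>
        would kill the larger span but not \<open>x\<close>, and could be normalised at
        \<open>x\<close>.\<close>
      have key: "E x = E y * F x" if E: "E \<in> B" "\<forall>z\<in>lspan ?W xs. E z = 0" for E
      proof (rule ccontr)
        assume neq: "E x \<noteq> E y * F x"
        define G where "G = (\<lambda>z. E z + (- E y) * F z)"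
        have G: "G \<in> B" unfolding G_def 
          by (rule op_algebraD(3)[OF B E(1) op_algebraD(5)[OF B F(1)]])
        have "G z = 0" if "z \<in> lspan ?W (y # xs)" for z
        proof -
          obtain v a where z: "z = v + a * y" "v \<in> lspan ?W xs" "a \<in> ?W" using \<open>z \<in> _\<close> by auto
          have "G v = 0" "G y = 0" using E(2) F(2,3) z(2) by (auto simp: G_def)
          then show ?thesis using lin_opD(1,2)[OF lin_op_centralizer[OF B G]] z by simp
        qed
        moreover have "G x \<noteq> 0" using neq by (simp add: G_def)
        moreover define H where "H = (\<lambda>z. inverse (G x) * G z)"
        ultimately have "H \<in> B" "\<forall>z\<in>lspan ?W (y # xs). H z = 0" "H x = 1"
          using op_algebraD(5)[OF B G, of "inverse (G x)"] by (simp_all del: lspan.simps)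
        then show False using no by blast
      qed
      have c: "F x \<in> ?W"
        unfolding centralizer_def
      proof (intro CollectI ballI allI)
        fix E z assume E: "E \<in> B"
        have E0: "E 0 = 0" using lin_opD(3)[OF lin_op_centralizer[OF B E]] .
        \<comment> \<open>This operator kills the span as well; since \<open>F y = 1\<close>,
          \<open>key\<close> says exactly that \<open>E\<close> commutes with
          \<open>F x\<close>.\<close>
        have "(\<lambda>t. E (z * F t)) \<in> B"
          by (rule op_algebraD(4)[OF B E op_algebraD(5)[OF B F(1)]])
        moreover have "\<forall>t\<in>lspan ?W xs. E (z * F t) = 0" using F(2) E0 by simp
        ultimately have "E (z * F x) = E (z * F y) * F x" by (rule key)
        then show "F x * E z = E (F x * z)" using F(3) by (simp add: mult.commute)
      qed
      \<comment> \<open>Now \<open>F x\<close> is an admissible coefficient, so the difference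
        avoids the smaller span; an operator from the induction hypothesis is nonzero there, against
        \<open>key\<close>.\<close>
      have "x - F x * y \<notin> lspan ?W xs"
      proof
        assume "x - F x * y \<in> lspan ?W xs"
        moreover have "x = (x - F x * y) + F x * y" by simp
        ultimately have "x \<in> lspan ?W (y # xs)" using c unfolding lspan.simps by blast
        then show False using Cons.prems by simp
      qed
      then obtain E where E: "E \<in> B" "\<forall>z\<in>lspan ?W xs. E z = 0" "E (x - F x * y) = 1"
        using Cons.IH by blast
      have "E (x - F x * y) = E x - F x * E y"
        using lin_opD(2,4)[OF lin_op_centralizer[OF B E(1)]] c by simp
      then show False using key[OF E(1,2)] E(3) by simp
    qed
  qed
qed

text \<open>Separating operators let an element of \<open>B\<close> match a given linear map on one
  more vector at a time; once a finite list spans everything, matching is equality.\<close>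

theorem jacobson_bourbaki:
  assumes B: "op_algebra B" and fin: "finite_over (centralizer B) UNIV"
  shows "B = {D. lin_op (centralizer B) D}"
proof -
  let ?W = "centralizer B"
  note W = subfield_centralizer[OF B]
  have dense: "\<exists>E\<in>B. \<forall>z\<in>lspan ?W xs. E z = D z" if D: "lin_op ?W D" for D xs
  proof (induction xs)
    case Nil
    have "(\<lambda>x. 0 * x) \<in> B" by (rule op_algebraD(1)[OF B])
    then show ?case using lin_opD(3)[OF D] by (intro bexI[of _ "\<lambda>x. 0 * x"]) auto
  next
    case (Cons y xs)
    then obtain E where E: "E \<in> B" "\<forall>z\<in>lspan ?W xs. E z = D z" by blast
    have "\<exists>G\<in>B. (\<forall>z\<in>lspan ?W xs. G z = D z) \<and> G y = D y"
    proof (cases "y \<in> lspan ?W xs")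
      case True
      then show ?thesis using E by auto
    next
      case False
      then obtain F where F: "F \<in> B" "\<forall>z\<in>lspan ?W xs. F z = 0" "F y = 1"
        using op_algebra_separating[OF B] by blast
      \<comment> \<open>The correction term vanishes on the earlier span, so it adjusts only the
        value at \<open>y\<close>.\<close>
      have "(\<lambda>z. E z + (D y - E y) * F z) \<in> B" 
        by (rule op_algebraD(3)[OF B E(1) op_algebraD(5)[OF B F(1)]])
      then show ?thesis
        using E F by (intro bexI[of _ "\<lambda>z. E z + (D y - E y) * F z"]) auto
    qed
    then obtain G where G: "G \<in> B" "\<forall>z\<in>lspan ?W xs. G z = D z" "G y = D y" by blast
    then have "\<forall>z\<in>lspan ?W (y # xs). G z = D z"
      using lin_opD(1,2)[OF D] lin_opD(1,2)[OF lin_op_centralizer[OF B G(1)]] by auto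
    then show ?case using G(1) by blast
  qed
  obtain xs where "lspan ?W xs = UNIV" using fin unfolding finite_over_def by auto
  then have "D \<in> B" if "lin_op ?W D" for D
    using dense[OF that, of xs] by (metis UNIV_I ext)
  then show ?thesis using lin_op_centralizer[OF B] by blast
qed

section \<open>Power towers and algebras of differential operators\<close>

lemma power_towerD:
  assumes "power_tower W"
  shows "subfield (W i)" "j \<le> i \<Longrightarrow> W j = compositum (W i) (ppow_field j)"
    "ppow_field i \<subseteq> W i" "j \<le> i \<Longrightarrow> W i \<subseteq> W j"
proof -
  show 1: "j \<le> i \<Longrightarrow> W j = compositum (W i) (ppow_field j)" for i j
    using assms by (simp add: power_tower_def)
  show "subfield (W i)" using assms by (simp add: power_tower_def)
  show "ppow_field i \<subseteq> W i" using 1[of i i] compositum_superset(2) by blast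
  show "j \<le> i \<Longrightarrow> W i \<subseteq> W j" using 1[of j i] compositum_superset(1) by blast
qed

lemma power_tower_0: "power_tower W \<Longrightarrow> W 0 = UNIV"
  using power_towerD(3)[of W 0] by (simp add: top.extremum_uniqueI)

text \<open>Consecutive levels suffice: substituting one into the next, the factor
  \<open>ppow_field i\<close> is absorbed by \<open>ppow_field j\<close> for
  \<open>j <= i\<close>.\<close>

lemma power_towerI:
  assumes sub: "\<And>i. subfield (W i)" and sup: "\<And>i. ppow_field i \<subseteq> (W i :: 'a::field set)"
    and step: "\<And>i. W i = compositum (W (Suc i)) (ppow_field i)"
  shows "power_tower W"
  unfolding power_tower_def
proof (intro conjI allI impI sub)
  fix i j :: nat assume "j \<le> i"
  then show "W j = compositum (W i) (ppow_field j)"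
  proof (induction i rule: dec_induct)
    case base
    show ?case
      using compositum_least[OF sub order_refl sup] compositum_superset(1)[of "W j" "ppow_field j"] by blast
  next
    case (step i)
    have "W i \<subseteq> compositum (W (Suc i)) (ppow_field j)"
      unfolding assms(3)[of i] using ppow_field_antimono[OF step.hyps(1)] compositum_superset
      by (intro compositum_least[OF subfield_compositum]) blast+
    then have "W j \<subseteq> compositum (W (Suc i)) (ppow_field j)"
      unfolding step.IH using compositum_superset by (intro compositum_least[OF subfield_compositum]) blast+
    moreover have "compositum (W (Suc i)) (ppow_field j) \<subseteq> W j"
    proof (rule compositum_least[OF sub _ sup])
      have "W (Suc i) \<subseteq> W i" using assms(3)[of i] compositum_superset(1) by blast
      also have "\<dots> \<subseteq> W j" using step.IH compositum_superset(1) by blast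
      finally show "W (Suc i) \<subseteq> W j" .
    qed
    ultimately show ?case by blast
  qed
qed

text \<open>The elements whose multiplication commutes with an additive map form a subfield, and
  this one contains both factors.\<close>

lemma lin_op_compositum:
  assumes "lin_op A D" "lin_op B D"
  shows "lin_op (compositum A B) D"
proof -
  have z: "D 0 = 0" "D (- x) = - D x" for x
    using lin_opD(3)[OF assms(1)] lin_opD(4)[OF assms(1), of 0 x] by simp_all
  let ?F = "{a. \<forall>x. D (a * x) = a * D x}"
  have "D (inverse a * x) = inverse a * D x" if a: "\<forall>x. D (a * x) = a * D x" for a x
  proof (cases "a = 0")
    case False
    have "D x = D (a * (inverse a * x))" using False by (simp add: field_simps)
    also have "\<dots> = a * D (inverse a * x)" using a by blast
    finally show ?thesis using False by (simp add: field_simps)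
  qed (simp add: z)
  then have "subfield ?F"
    unfolding subfield_def mem_Collect_eq using z lin_opD(1)[OF assms(1)]
    by (simp add: distrib_right mult.assoc)
  then have "compositum A B \<subseteq> ?F"
    using lin_opD(2)[OF assms(1)] lin_opD(2)[OF assms(2)] by (intro compositum_least) auto
  then show ?thesis using lin_opD(1)[OF assms(1)] unfolding lin_op_def by blast
qed

text \<open>The base field is recovered as the centralizer of its linear operators.\<close>

lemma lin_op_inj:
  assumes "subfield A" "finite_over A UNIV" "subfield B" "finite_over B UNIV"
    and "{D. lin_op A D} = {D. lin_op B D}"
  shows "A = B"
proof -
  have "lin_op A = lin_op B" using assms(5) by blast
  then have "{x. \<forall>E. lin_op A E \<longrightarrow> (\<forall>y. x * E y = E (x * y))} = {x. \<forall>E. lin_op B E \<longrightarrow> (\<forall>y. x * E y = E (x * y))}"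
    by (simp only:)
  then show ?thesis unfolding centralizer_lin_op[OF assms(1,2)] centralizer_lin_op[OF assms(3,4)] .
qed

lemma finite_over_base_mono: "A \<subseteq> B \<Longrightarrow> finite_over A V \<Longrightarrow> finite_over B V"
  unfolding finite_over_def using lspan_base_mono by blast

section \<open>Passing between towers and algebras\<close>

context
  assumes char_pos: "CHAR('a::field) > 0" and fin_gen: "fin_gen_over (perfect_core :: 'a set)"
begin

lemma finite_over_UNIV: "ppow_field n \<subseteq> A \<Longrightarrow> finite_over A (UNIV :: 'a set)"
  using finite_over_base_mono finite_over_ppow_field[OF char_pos fin_gen] by blast

lemma Diff_ppow_field: "Diff (ppow_field n :: 'a set) = {D. lin_op (ppow_field n) D}"
  by (rule Diff_eq_lin_op[OF char_pos subfield_ppow_field[OF char_pos] order_refl finite_over_UNIV[OF order_refl]])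

lemma Diff_power_tower: "power_tower (W :: nat \<Rightarrow> 'a set) \<Longrightarrow> Diff (W n) = {D. lin_op (W n) D}"
  by (rule Diff_eq_lin_op[OF char_pos power_towerD(1,3) finite_over_UNIV[OF power_towerD(3)]])

lemma K_subalg_tower_to_alg:
  fixes W :: "nat \<Rightarrow> 'a set"
  assumes W: "power_tower W"
  shows "K_subalg (tower_to_alg W)"
proof -
  have mem: "D \<in> tower_to_alg W \<longleftrightarrow> (\<exists>n. lin_op (W n) D)" for D
    by (simp add: tower_to_alg_def Diff_power_tower[OF W])
  \<comment> \<open>The tower decreases, so two operators are both linear over the smaller of their
    base fields.\<close>
  have two: "\<exists>n. lin_op (W n) D \<and> lin_op (W n) E" if "lin_op (W m) D" "lin_op (W n) E" for m n D E
    using that power_towerD(4)[OF W, of m "max m n"] power_towerD(4)[OF W, of n "max m n"]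
    by (meson lin_op_antimono max.cobounded1 max.cobounded2)
  have "Diff (W n) \<subseteq> Diff perfect_core" for n
    using perfect_core_subset[of n] power_towerD(3)[OF W, of n] unfolding Diff_def by blast
  then have "tower_to_alg W \<subseteq> Diff perfect_core" unfolding tower_to_alg_def by blast
  moreover have "(\<lambda>x. c * x) \<in> tower_to_alg W" for c
    unfolding mem by (auto simp: lin_op_def distrib_left mult.left_commute)
  moreover have "(\<lambda>x. D x + E x) \<in> tower_to_alg W" "D \<circ> E \<in> tower_to_alg W"
    if DE: "D \<in> tower_to_alg W" "E \<in> tower_to_alg W" for D E
  proof -
    obtain n where n: "lin_op (W n) D" "lin_op (W n) E" using DE two unfolding mem by blast
    have "lin_op (W n) (\<lambda>x. D x + E x)" "lin_op (W n) (D \<circ> E)"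
      using lin_opD(1,2)[OF n(1)] lin_opD(1,2)[OF n(2)] unfolding lin_op_def
      by (simp_all add: distrib_left add_ac)
    then show "(\<lambda>x. D x + E x) \<in> tower_to_alg W" "D \<circ> E \<in> tower_to_alg W" unfolding mem by blast+
  qed
  moreover have "(\<lambda>x. c * D x) \<in> tower_to_alg W" if "D \<in> tower_to_alg W" for c D
    using that unfolding mem by (auto simp: lin_op_def distrib_left mult.left_commute)
  ultimately show ?thesis unfolding K_subalg_def by simp
qed

text \<open>For \<open>m <= n\<close>, linearity over \<open>W n\<close> and over
  \<open>ppow_field m\<close> is linearity over their compositum, which the tower condition
  identifies with \<open>W m\<close>; for \<open>m > n\<close> it suffices that \<open>W m\<close>
  lies in \<open>W n\<close>.\<close>

lemma tower_to_alg_Int_Diff: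
  fixes W :: "nat \<Rightarrow> 'a set"
  assumes W: "power_tower W"
  shows "tower_to_alg W \<inter> Diff (ppow_field m) = {D. lin_op (W m) D}"
proof -
  have "lin_op (W m) D" if "lin_op (W n) D" "lin_op (ppow_field m) D" for n D
  proof (cases "m \<le> n")
    case True
    then show ?thesis using lin_op_compositum[OF that] power_towerD(2)[OF W] by simp
  next
    case False
    then show ?thesis using that(1) lin_op_antimono power_towerD(4)[OF W, of n m] by simp
  qed
  then show ?thesis
    unfolding tower_to_alg_def Diff_power_tower[OF W] Diff_ppow_field
    using lin_op_antimono[OF power_towerD(3)[OF W]] by blast
qed

lemma alg_to_tower_eq_centralizer: "alg_to_tower DD m = centralizer (DD \<inter> Diff (ppow_field m))"
  by (simp add: alg_to_tower_def centralizer_def)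

lemma alg_to_tower_tower_to_alg:
  fixes W :: "nat \<Rightarrow> 'a set"
  assumes W: "power_tower W"
  shows "alg_to_tower (tower_to_alg W) = W"
proof
  fix m
  show "alg_to_tower (tower_to_alg W) m = W m"
    unfolding alg_to_tower_eq_centralizer tower_to_alg_Int_Diff[OF W] centralizer_def
    using centralizer_lin_op[OF power_towerD(1)[OF W] finite_over_UNIV[OF power_towerD(3)[OF W]]] by simp
qed

lemma op_algebra_K_subalg_Int:
  assumes DD: "K_subalg (DD :: ('a \<Rightarrow> 'a) set)"
  shows "op_algebra (DD \<inter> Diff (ppow_field n))"
proof -
  have "lin_op (ppow_field n) (\<lambda>x. c * x)" for c :: 'a
    by (simp add: lin_op_def distrib_left mult.left_commute)
  moreover have "lin_op (ppow_field n) (\<lambda>x. D x + E x)" "lin_op (ppow_field n) (D \<circ> E)"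
    if "lin_op (ppow_field n) D" "lin_op (ppow_field n) E" for D E :: "'a \<Rightarrow> 'a"
    using lin_opD(1,2)[OF that(1)] lin_opD(1,2)[OF that(2)] unfolding lin_op_def
    by (simp_all add: distrib_left add_ac)
  moreover have "\<forall>D\<in>DD \<inter> {D. lin_op (ppow_field n) D}. \<forall>x y. D (x + y) = D x + D y"
    using lin_opD(1) by blast
  ultimately show ?thesis
    using DD unfolding op_algebra_def K_subalg_def Diff_ppow_field by simp
qed

lemma K_subalg_Int_Diff:
  assumes DD: "K_subalg (DD :: ('a \<Rightarrow> 'a) set)"
  shows "subfield (alg_to_tower DD n)" "ppow_field n \<subseteq> alg_to_tower DD n"
    "DD \<inter> Diff (ppow_field n) = {D. lin_op (alg_to_tower DD n) D}"
proof -
  note B = op_algebra_K_subalg_Int[OF DD, of n]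
  show "subfield (alg_to_tower DD n)"
    unfolding alg_to_tower_eq_centralizer by (rule subfield_centralizer[OF B])
  show sup: "ppow_field n \<subseteq> alg_to_tower DD n"
    unfolding alg_to_tower_def Diff_ppow_field by (auto simp: lin_op_def)
  show "DD \<inter> Diff (ppow_field n) = {D. lin_op (alg_to_tower DD n) D}"
    using jacobson_bourbaki[OF B] finite_over_UNIV[OF sup] by (simp add: alg_to_tower_eq_centralizer)
qed

text \<open>The operators of layer \<open>i\<close> are those of layer \<open>Suc i\<close> that are
  also linear over \<open>ppow_field i\<close>, hence exactly those linear over the compositum; and
  a field is determined by its linear operators.\<close>

lemma power_tower_alg_to_tower:
  assumes DD: "K_subalg (DD :: ('a \<Rightarrow> 'a) set)"
  shows "power_tower (alg_to_tower DD)"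
proof (rule power_towerI)
  let ?W = "alg_to_tower DD"
  fix i
  show "subfield (?W i)" "ppow_field i \<subseteq> ?W i" by (rule K_subalg_Int_Diff[OF DD])+
  let ?C = "compositum (?W (Suc i)) (ppow_field i)"
  have "lin_op (ppow_field (Suc i)) D" if "lin_op (ppow_field i) D" for D :: "'a \<Rightarrow> 'a"
    using lin_op_antimono[OF ppow_field_antimono that] by simp
  then have "{D. lin_op (?W i) D} = {D. lin_op (?W (Suc i)) D} \<inter> {D. lin_op (ppow_field i) D}"
    unfolding K_subalg_Int_Diff(3)[OF DD, symmetric] unfolding Diff_ppow_field by blast
  also have "\<dots> = {D. lin_op ?C D}"
    using lin_op_compositum[of "?W (Suc i)" _ "ppow_field i"]
      lin_op_antimono[OF compositum_superset(1)[of "?W (Suc i)" "ppow_field i"]]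
      lin_op_antimono[OF compositum_superset(2)[of "ppow_field i" "?W (Suc i)"]] by blast
  finally show "?W i = ?C"
    by (rule lin_op_inj[OF K_subalg_Int_Diff(1)[OF DD] finite_over_UNIV[OF K_subalg_Int_Diff(2)[OF DD]]
          subfield_compositum finite_over_UNIV[OF compositum_superset(2)]])
qed

lemma tower_to_alg_alg_to_tower:
  assumes DD: "K_subalg (DD :: ('a \<Rightarrow> 'a) set)"
  shows "tower_to_alg (alg_to_tower DD) = DD"
proof -
  \<comment> \<open>Finite order puts every operator into some layer, so the layers exhaust the
    algebra.\<close>
  have "\<exists>n. D \<in> Diff (ppow_field n)" if "D \<in> DD" for D
    using that DD Diff_perfect_core_imp_lin_op[OF char_pos, of D] unfolding K_subalg_def Diff_ppow_field
    by blast
  then have "DD = (\<Union>n. DD \<inter> Diff (ppow_field n))" by blast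
  then show ?thesis
    unfolding tower_to_alg_def Diff_power_tower[OF power_tower_alg_to_tower[OF DD]]
      K_subalg_Int_Diff(3)[OF DD, symmetric] by simp
qed

end

section \<open>Derivations\<close>

text \<open>Values may leave \<open>M\<close> and are unconstrained outside it; this covers
  restrictions to subfields as well as partial extensions \<open>M -> F\<close> of a derivation
  under construction.\<close>

definition deriv_on :: "'a::field set \<Rightarrow> ('a \<Rightarrow> 'a) \<Rightarrow> bool" where
  "deriv_on M D \<longleftrightarrow> (\<forall>x\<in>M. \<forall>y\<in>M. D (x + y) = D x + D y \<and> D (x * y) = x * D y + y * D x)"

lemma deriv_onD:
  assumes "deriv_on M D" "subfield M"
  shows "x \<in> M \<Longrightarrow> y \<in> M \<Longrightarrow> D (x + y) = D x + D y"
    "x \<in> M \<Longrightarrow> y \<in> M \<Longrightarrow> D (x * y) = x * D y + y * D x"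
    "D 0 = 0" "D 1 = 0" "x \<in> M \<Longrightarrow> D (- x) = - D x" "x \<in> M \<Longrightarrow> y \<in> M \<Longrightarrow> D (x - y) = D x - D y"
    "x \<in> M \<Longrightarrow> D (x ^ n) = of_nat n * x ^ (n - 1) * D x"
proof -
  note M = subfield_closed[OF assms(2)]
  show add: "x \<in> M \<Longrightarrow> y \<in> M \<Longrightarrow> D (x + y) = D x + D y" for x y
    using assms(1) by (simp add: deriv_on_def)
  show mult: "x \<in> M \<Longrightarrow> y \<in> M \<Longrightarrow> D (x * y) = x * D y + y * D x" for x y
    using assms(1) by (simp add: deriv_on_def)
  show zero: "D 0 = 0" using add[of 0 0] M(1) by (metis add_0 add_cancel_right_right)
  show one: "D 1 = 0" using mult[of 1 1] M(2) by (metis add_cancel_right_right mult_1)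
  show neg: "x \<in> M \<Longrightarrow> D (- x) = - D x" for x
    using add[of x "- x"] M(5)[of x] zero by (simp add: eq_neg_iff_add_eq_0 add.commute)
  show "x \<in> M \<Longrightarrow> y \<in> M \<Longrightarrow> D (x - y) = D x - D y"
    using add[of x "- y"] neg[of y] M(5)[of y] by simp
  show "D (x ^ n) = of_nat n * x ^ (n - 1) * D x" if x: "x \<in> M"
  proof (induction n)
    case (Suc n)
    have "x * (of_nat n * x ^ (n - 1) * D x) = of_nat n * x ^ n * D x" by (cases n) auto
    then show ?case
      using mult[OF x subfield_power[OF assms(2) x, of n]] Suc by (simp add: algebra_simps)
  qed (simp add: one)
qed

lemma deriv_on_subset: "deriv_on M D \<Longrightarrow> N \<subseteq> M \<Longrightarrow> deriv_on N D"
  unfolding deriv_on_def by blast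

lemma subfield_kernel:
  assumes M: "subfield M" and D: "deriv_on M D"
  shows "subfield {x \<in> M. D x = 0}"
proof -
  have "D (inverse x) = 0" if x: "x \<in> M" "D x = 0" for x
  proof (cases "x = 0")
    case False
    have "x * D (inverse x) + inverse x * D x = 0"
      using deriv_onD(2)[OF D M x(1) subfield_closed(6)[OF M x(1)]] deriv_onD(4)[OF D M] False by simp
    then show ?thesis using x False by simp
  qed (use x in simp)
  then show ?thesis
    unfolding subfield_def mem_Collect_eq
    using deriv_onD(1-5)[OF D M] subfield_closed(1-6)[OF M] by simp
qed

lemma deriv_on_diff:
  "deriv_on M D \<Longrightarrow> deriv_on M E \<Longrightarrow> deriv_on M (\<lambda>x. D x - E x)"
  unfolding deriv_on_def by (auto simp: algebra_simps)

lemma derivation_alt: "derivation F D \<longleftrightarrow> deriv_on F D \<and> (\<forall>x. x \<notin> F \<longrightarrow> D x = 0) \<and> (\<forall>x\<in>F. D x \<in> F)"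
  unfolding derivation_def deriv_on_def by blast

text \<open>The difference is a derivation, and its kernel is a subfield containing the generators.
  Generation is phrased through all subfields \<open>M\<close> so that such a kernel can be inserted
  directly.\<close>

lemma derivation_eqI:
  assumes F: "subfield F" and D: "derivation F D" and E: "derivation F E"
    and gen: "\<And>M. subfield M \<Longrightarrow> A \<subseteq> M \<Longrightarrow> S \<subseteq> M \<Longrightarrow> F \<subseteq> M"
    and A: "A \<subseteq> F" "\<And>a. a \<in> A \<Longrightarrow> D a = E a" and S: "S \<subseteq> F" "\<And>s. s \<in> S \<Longrightarrow> D s = E s"
  shows "D = E"
proof
  fix x
  have "deriv_on F (\<lambda>x. D x - E x)" using D E by (intro deriv_on_diff) (auto simp: derivation_alt)
  then have "F \<subseteq> {x \<in> F. D x - E x = 0}"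
    using A S by (intro gen subfield_kernel[OF F]) auto
  moreover have "D x = E x" if "x \<notin> F" using D E that by (simp add: derivation_alt)
  ultimately show "D x = E x" by (cases "x \<in> F") auto
qed

section \<open>Extending derivations to purely inseparable extensions of height one\<close>

context
  assumes char_pos: "CHAR('a::field) > 0"
begin

lemma of_nat_less_char_neq_0: "0 < n \<Longrightarrow> n < CHAR('a) \<Longrightarrow> (of_nat n :: 'a) \<noteq> 0"
  using of_nat_eq_0_iff_char_dvd[where 'a = 'a] by (auto dest: dvd_imp_le)

lemma deriv_on_char_power: "deriv_on M D \<Longrightarrow> subfield M \<Longrightarrow> x \<in> M \<Longrightarrow> D ((x :: 'a) ^ CHAR('a)) = 0"
  by (simp add: deriv_onD(7))

text \<open>The minimal polynomial of \<open>s\<close> over \<open>M\<close> divides \<open>(X - s) ^ p\<close>, so its degree is its order at \<open>s\<close>;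
  being separable in degrees below \<open>p\<close>, it would have to be linear.\<close>

lemma power_basis_independent:
  fixes M :: "'a set"
  assumes M: "subfield M" and s: "s \<notin> M" "s ^ CHAR('a) \<in> M"
    and a: "\<And>i. i < CHAR('a) \<Longrightarrow> a i \<in> M" "(\<Sum>i<CHAR('a). a i * s ^ i) = 0"
  shows "\<forall>i<CHAR('a). a i = 0"
proof (rule ccontr)
  let ?p = "CHAR('a)"
  assume "\<not> ?thesis"
  then obtain j where j: "j < ?p" "a j \<noteq> 0" by auto
  define P where "P f \<longleftrightarrow> (\<forall>i. coeff f i \<in> M) \<and> f \<noteq> 0 \<and> poly f s = 0" for f
  define f0 where "f0 = (\<Sum>i<?p. monom (a i) i)"
  have coeff0: "coeff f0 i = (if i < ?p then a i else 0)" for i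
    unfolding f0_def coeff_sum coeff_monom by (simp add: sum.delta)
  have "P f0"
    unfolding P_def
  proof (intro conjI allI)
    show "coeff f0 i \<in> M" for i using coeff0 a(1) subfield_closed(1)[OF M] by simp
    show "f0 \<noteq> 0" using coeff0[of j] j by auto
    show "poly f0 s = 0" unfolding f0_def poly_sum poly_monom using a(2) by simp
  qed
  then obtain f where f: "P f" "\<And>g. P g \<Longrightarrow> degree f \<le> degree g"
    using ex_has_least_nat[of P f0 degree] by blast
  have "degree f0 < ?p"
    using coeff0 j by (intro degree_lessI) auto
  then have deg: "degree f < ?p" using f(2)[OF \<open>P f0\<close>] by simp
  have fM: "coeff f i \<in> M" "f \<noteq> 0" "poly f s = 0" for i using f(1) by (auto simp: P_def)
  \<comment> \<open>Minimality of the degree makes \<open>f\<close> divide every polynomial over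
    \<open>M\<close> that vanishes at \<open>s\<close>, by descent on the degree.\<close>
  have dvd: "f dvd h" if "\<forall>i. coeff h i \<in> M" "poly h s = 0" for h
    using that
  proof (induction "degree h" arbitrary: h rule: less_induct)
    case less
    show ?case
    proof (cases "h = 0")
      case False
      then have le: "degree f \<le> degree h" using f(2)[of h] less.prems by (simp add: P_def)
      define k where "k = degree h - degree f"
      \<comment> \<open>Cross-multiplying by the leading coefficients cancels the top term and keeps
        all coefficients in \<open>M\<close>.\<close>
      define g where "g = smult (lead_coeff f) h - smult (lead_coeff h) (monom 1 k * f)"
      have cg: "coeff g i = lead_coeff f * coeff h i - lead_coeff h * (if k \<le> i then coeff f (i - k) else 0)" for i
        by (simp add: g_def coeff_monom_mult)
      have "\<forall>i. coeff g i \<in> M"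
        using cg less.prems(1) fM(1) subfield_closed[OF M] by simp
      moreover have "poly g s = 0" using less.prems(2) fM(3) by (simp add: g_def)
      moreover have "degree g < degree h" if "g \<noteq> 0"
      proof -
        have "coeff g i = 0" if "i \<ge> degree h" for i
        proof (cases "i = degree h")
          case True
          then show ?thesis using cg[of i] le by (simp add: k_def mult.commute)
        next
          case False
          then show ?thesis
            using cg[of i] that le by (simp add: k_def coeff_eq_0)
        qed
        then show ?thesis using \<open>g \<noteq> 0\<close> by (metis leading_coeff_0_iff not_le)
      qed
      ultimately have "f dvd g" using less.hyps[of g] by (cases "g = 0") auto
      moreover have "smult (lead_coeff f) h = g + smult (lead_coeff h) (monom 1 k) * f"
        by (simp add: g_def)
      ultimately have "f dvd smult (lead_coeff f) h" by (metis dvd_add dvd_triv_right)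
      then show ?thesis using fM(2) by (simp add: dvd_smult_iff)
    qed simp
  qed
  let ?h = "[:- s, 1:] ^ ?p"
  \<comment> \<open>Frobenius in the polynomial ring shows that
    \<open>(X - s) ^ p = X ^ p + (- s) ^ p\<close> has coefficients in \<open>M\<close>.\<close>
  have "prime CHAR('a poly)" using prime_char[OF char_pos] by simp
  then have "([:0, 1:] + [:- s:]) ^ ?p = [:0, 1:] ^ ?p + [:- s:] ^ ?p"
    by (rule freshmans_dream) simp
  then have h: "?h = monom 1 ?p + [:(- s) ^ ?p:]"
    by (simp add: monom_altdef poly_const_pow)
  have "(- s) ^ ?p \<in> M"
    using frobenius_uminus[OF char_pos, of s 1] s(2) subfield_closed(5)[OF M] by simp
  then have "\<forall>i. coeff ?h i \<in> M"
    unfolding h using subfield_closed(1-3)[OF M] by (auto simp: coeff_pCons split: nat.split)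
  moreover have "poly ?h s = 0" using char_pos by simp
  ultimately obtain g where g: "?h = f * g" using dvd by blast
  have "?h \<noteq> 0" by simp
  then have "g \<noteq> 0" using g by auto
  \<comment> \<open>Orders and degrees of the two factors have the same sum, and no order exceeds
    its degree, so both are equal.\<close>
  have "order s f + order s g = ?p"
    using order_mult[of f g s] \<open>?h \<noteq> 0\<close> g order_power_n_n[of s ?p] by simp
  moreover have "degree f + degree g = ?p"
    using degree_mult_eq[OF fM(2) \<open>g \<noteq> 0\<close>] g degree_linear_power[of "- s" ?p] by simp
  ultimately have ord: "order s f = degree f"
    using order_degree[OF fM(2), of s] order_degree[OF \<open>g \<noteq> 0\<close>, of s] by linarith
  have pos: "degree f \<noteq> 0"
  proof
    assume "degree f = 0"
    then obtain c where "f = [:c:]" by (metis degree_0_id)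
    then show False using fM by simp
  qed
  have "degree f = 1"
  proof (rule ccontr)
    assume "degree f \<noteq> 1"
    then have "2 \<le> order s f" using pos ord by simp
    then have "[:- s, 1:] ^ 2 dvd f" unfolding order_divides by simp
    \<comment> \<open>A double root would also be a root of the derivative. That derivative is
      nonzero because its leading factor \<open>degree f\<close> is below \<open>p\<close>, and its
      smaller degree contradicts minimality.\<close>
    then obtain c where c: "f = [:- s, 1:] * ([:- s, 1:] * c)"
      unfolding power2_eq_square mult.assoc by (elim dvdE) (simp only: mult.assoc)
    have "poly (pderiv f) s = 0" unfolding c pderiv_mult by simp
    moreover have "coeff (pderiv f) (degree f - 1) \<noteq> 0"
      using of_nat_less_char_neq_0[of "degree f"] pos deg fM(2) by (simp add: coeff_pderiv)
    then have "pderiv f \<noteq> 0" by auto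
    moreover have "\<forall>i. coeff (pderiv f) i \<in> M"
      unfolding coeff_pderiv using fM(1) subfield_of_nat[OF M] subfield_closed(4)[OF M] by blast
    ultimately have "degree f \<le> degree (pderiv f)" using f(2) by (simp add: P_def)
    moreover have "degree (pderiv f) \<le> degree f - 1"
      by (intro degree_le allI impI) (simp add: coeff_pderiv coeff_eq_0)
    ultimately show False using pos by linarith
  qed
  moreover obtain b g where bg: "f = pCons b g" by (cases f)
  ultimately have "g \<noteq> 0" "degree g = 0" by (auto split: if_splits)
  then obtain c where bc: "f = [:b, c:]" "c \<noteq> 0" using bg by (metis degree_0_id pCons_0_0)
  then have "s = - b / c" using fM(3) by (simp add: field_simps eq_neg_iff_add_eq_0)
  moreover have "b \<in> M" "c \<in> M" using fM(1)[of 0] fM(1)[of 1] bc by simp_all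
  ultimately show False using s(1) subfield_closed(5,8)[OF M] by simp
qed

text \<open>The extension is defined on coordinates in the basis of powers of \<open>s\<close> below
  \<open>p\<close>. The relation expressing \<open>s ^ p\<close> in \<open>M\<close> is respected
  because both \<open>D (s ^ p)\<close> and \<open>p * s ^ (p - 1) * u\<close> are 0.\<close>

lemma deriv_on_extend:
  fixes M :: "'a set"
  assumes M: "subfield M" and s: "s \<notin> M" "s ^ CHAR('a) \<in> M"
    and D: "deriv_on M D" "D (s ^ CHAR('a)) = 0"
    and F: "subfield F" "M \<subseteq> F" "\<And>x. x \<in> M \<Longrightarrow> D x \<in> F" "s \<in> F" "u \<in> F"
  shows "\<exists>D'. deriv_on (adjoin CHAR('a) M s) D' \<and> (\<forall>x\<in>M. D' x = D x) \<and> D' s = u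
      \<and> (\<forall>x \<in> adjoin CHAR('a) M s. D' x \<in> F)"
proof -
  let ?p = "CHAR('a)"
  let ?N = "adjoin ?p M s"
  note V = subspace_over_closed[OF subspace_over_adjoin[OF M]]
  define S where "S a = (\<Sum>i<?p. a i * s ^ i)" for a
  \<comment> \<open>The value that the power rule forces on \<open>s ^ n\<close> once
    \<open>s\<close> is sent to \<open>u\<close>.\<close>
  define T where "T n = of_nat n * s ^ (n - 1) * u" for n
  define G where "G a = (\<Sum>i<?p. D (a i) * s ^ i + a i * T i)" for a
  define D' where "D' y = G (SOME a. (\<forall>i. a i \<in> M) \<and> y = S a)" for y
  have N: "\<exists>a. (\<forall>i. a i \<in> M) \<and> y = S a" if "y \<in> ?N" for y
    using that by (auto simp: adjoin_def S_def)
  have D'_S: "D' (S a) = G a" if a: "\<And>i. a i \<in> M" for a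
  proof -
    define b where "b = (SOME b. (\<forall>i. b i \<in> M) \<and> S a = S b)"
    have b: "(\<forall>i. b i \<in> M) \<and> S a = S b"
      unfolding b_def by (rule someI[of _ a]) (use a in simp)
    have "(\<Sum>i<?p. (a i - b i) * s ^ i) = 0"
      using b by (simp add: S_def left_diff_distrib sum_subtractf)
    then have "\<forall>i<?p. a i - b i = 0"
      using a b subfield_closed(7)[OF M] by (intro power_basis_independent[OF M s]) auto
    then have "G a = G b" unfolding G_def by (intro sum.cong) auto
    then show ?thesis by (simp add: D'_def b_def)
  qed
  have add: "D' (x + y) = D' x + D' y" if xy: "x \<in> ?N" "y \<in> ?N" for x y
  proof -
    obtain a b where ab: "\<And>i. a i \<in> M" "x = S a" "\<And>i. b i \<in> M" "y = S b"
      using N[OF xy(1)] N[OF xy(2)] by blast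
    have "x + y = S (\<lambda>i. a i + b i)" by (simp add: ab S_def distrib_right sum.distrib)
    then have "D' (x + y) = G (\<lambda>i. a i + b i)" using ab subfield_closed(3)[OF M] D'_S by simp
    also have "\<dots> = G a + G b"
      using deriv_onD(1)[OF D(1) M] ab by (simp add: G_def algebra_simps sum.distrib)
    finally show ?thesis using D'_S ab by simp
  qed
  have zero: "D' 0 = 0" using add[OF V(1) V(1)] by (metis add_0 add_cancel_right_right)
  have sum: "D' (sum f I) = (\<Sum>i\<in>I. D' (f i))" if "\<And>i. i \<in> I \<Longrightarrow> f i \<in> ?N" for f and I :: "nat set"
    using that
  proof (induction I rule: infinite_finite_induct)
    case (insert i I)
    then show ?case
      using add[of "f i" "sum f I"] subspace_over_sum[OF subspace_over_adjoin[OF M], of I f] by simp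
  qed (use zero in auto)
  have monom_mem: "m * s ^ n \<in> ?N" if "m \<in> M" for m n
    by (rule adjoin_power_mem[OF M s(2) char_pos that])
  \<comment> \<open>Products produce exponents beyond the basis, so the formula is proved for every
    \<open>n\<close>: the excess power \<open>t\<close> of \<open>s ^ p\<close> is a constant for
    \<open>D\<close>, and \<open>n\<close> equals its remainder \<open>r\<close> in characteristic
    \<open>p\<close>.\<close>
  have monom: "D' (m * s ^ n) = D m * s ^ n + m * T n" if m: "m \<in> M" for m n
  proof -
    define q where "q = n div ?p"
    define r where "r = n mod ?p"
    have n: "n = ?p * q + r" by (simp add: q_def r_def)
    have r: "r < ?p" using char_pos by (simp add: r_def)
    define t where "t = (s ^ ?p) ^ q"
    have t: "t \<in> M" unfolding t_def by (intro subfield_power M s)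
    have sn: "s ^ n = t * s ^ r" unfolding n t_def by (simp add: power_add power_mult)
    have Tn: "T n = t * T r"
    proof (cases "r = 0")
      case True
      then show ?thesis by (simp add: T_def n)
    next
      case False
      then have "s ^ (n - 1) = t * s ^ (r - 1)"
        unfolding n t_def by (simp add: power_mult[symmetric] power_add[symmetric])
      moreover have "(of_nat n :: 'a) = of_nat r" by (simp add: n)
      ultimately show ?thesis by (simp add: T_def)
    qed
    have Dt: "D t = 0" unfolding t_def using deriv_onD(7)[OF D(1) M s(2)] D(2) by simp
    let ?a = "\<lambda>i. if i = r then m * t else 0"
    have "S ?a = (\<Sum>i<?p. if i = r then (m * t) * s ^ i else 0)"
      unfolding S_def by (intro sum.cong) auto
    then have "m * s ^ n = S ?a" using r by (simp add: sn sum.delta mult.assoc)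
    then have "D' (m * s ^ n) = G ?a"
      using D'_S[of ?a] m t subfield_closed(1,4)[OF M] by simp
    also have "\<dots> = (\<Sum>i<?p. if i = r then D (m * t) * s ^ i + (m * t) * T i else 0)"
      unfolding G_def using deriv_onD(3)[OF D(1) M] by (intro sum.cong) auto
    also have "\<dots> = D (m * t) * s ^ r + (m * t) * T r" using r by (simp add: sum.delta)
    finally show ?thesis using deriv_onD(2)[OF D(1) M m t] Dt by (simp add: sn Tn algebra_simps)
  qed
  have T_add: "T (i + j) = s ^ i * T j + s ^ j * T i" for i j
    by (cases i; cases j) (simp_all add: T_def power_add algebra_simps)
  have mult: "D' (x * y) = x * D' y + y * D' x" if xy: "x \<in> ?N" "y \<in> ?N" for x y
  proof -
    obtain a b where ab: "\<And>i. a i \<in> M" "x = S a" "\<And>i. b i \<in> M" "y = S b"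
      using N[OF xy(1)] N[OF xy(2)] by blast
    have abM: "a i * b j \<in> M" for i j using ab subfield_closed(4)[OF M] by blast
    have xy': "x * y = (\<Sum>i<?p. \<Sum>j<?p. (a i * b j) * s ^ (i + j))"
      unfolding ab S_def sum_product by (simp add: power_add mult_ac)
    have "D' (x * y) = (\<Sum>i<?p. D' (\<Sum>j<?p. (a i * b j) * s ^ (i + j)))"
      unfolding xy' by (intro sum subspace_over_sum[OF subspace_over_adjoin[OF M]] monom_mem abM)
    also have "\<dots> = (\<Sum>i<?p. \<Sum>j<?p. D' ((a i * b j) * s ^ (i + j)))"
      by (intro sum.cong refl sum monom_mem abM)
    also have "\<dots> = (\<Sum>i<?p. \<Sum>j<?p. (a i * s ^ i) * (D (b j) * s ^ j + b j * T j)
        + (b j * s ^ j) * (D (a i) * s ^ i + a i * T i))"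
      unfolding monom[OF abM] deriv_onD(2)[OF D(1) M ab(1) ab(3)] unfolding T_add power_add
      by (intro sum.cong refl) (simp add: algebra_simps)
    also have "\<dots> = (\<Sum>i<?p. \<Sum>j<?p. (a i * s ^ i) * (D (b j) * s ^ j + b j * T j))
        + (\<Sum>j<?p. \<Sum>i<?p. (b j * s ^ j) * (D (a i) * s ^ i + a i * T i))"
      unfolding sum.distrib by (subst (2) sum.swap) (rule refl)
    also have "\<dots> = S a * G b + S b * G a"
      unfolding S_def G_def sum_product ..
    finally show ?thesis using D'_S ab by simp
  qed
  have DM: "D' x = D x" if "x \<in> M" for x using monom[OF that, of 0] by (simp add: T_def)
  have "D' s = u" using monom[OF subfield_closed(2)[OF M], of 1] deriv_onD(4)[OF D(1) M] by (simp add: T_def)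
  moreover have "D' x \<in> F" if x: "x \<in> ?N" for x
  proof -
    obtain a where a: "\<And>i. a i \<in> M" "x = S a" using N[OF x] by blast
    have "G a \<in> F"
      unfolding G_def T_def using a F(2-5)
      by (intro subfield_sum[OF F(1)] subfield_closed(3,4)[OF F(1)] subfield_power[OF F(1)] subfield_of_nat[OF F(1)]) auto
    then show ?thesis using D'_S a by simp
  qed
  ultimately show ?thesis using add mult DM unfolding deriv_on_def by blast
qed

lemma subfield_adjoin_char:
  fixes M :: "'a set"
  assumes "subfield M" "s ^ CHAR('a) \<in> M"
  shows "subfield (adjoin CHAR('a) M s)" "s \<in> adjoin CHAR('a) M s" "M \<subseteq> adjoin CHAR('a) M s"
  using subfield_adjoin[OF char_pos assms(1), of s 1] adjoin_generator_mem[OF char_pos assms(1), of s 1]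
    assms adjoin_superset[OF assms(1) char_pos] by auto

text \<open>The zero derivation on \<open>A\<close> is first extended to \<open>x\<close> with value
  1, then to the remaining generators with value 0; each extension keeps the earlier values.\<close>

lemma ex_derivation_neq_0:
  fixes A F :: "'a set"
  assumes A: "subfield A" and F: "subfield F" "A \<subseteq> F" "\<And>y. y \<in> F \<Longrightarrow> y ^ CHAR('a) \<in> A"
    and S: "finite S" "S \<subseteq> F" "F \<subseteq> gen_field (A \<union> S)" and x: "x \<in> F" "x \<notin> A"
  shows "\<exists>D \<in> RelDer F A. D x \<noteq> 0"
proof -
  define P where "P M D \<longleftrightarrow> subfield M \<and> A \<subseteq> M \<and> x \<in> M \<and> M \<subseteq> F \<and> deriv_on M D \<and> (\<forall>a\<in>A. D a = 0)
    \<and> D x = 1 \<and> (\<forall>y\<in>M. D y \<in> F)" for M D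
  have "\<exists>M D. P M D \<and> S \<subseteq> M" using S(1,2)
  proof (induction S rule: finite_induct)
    case empty
    have "deriv_on A (\<lambda>_. 0)" by (simp add: deriv_on_def)
    then obtain D where D: "deriv_on (adjoin CHAR('a) A x) D" "\<forall>a\<in>A. D a = 0" "D x = 1"
        "\<forall>y \<in> adjoin CHAR('a) A x. D y \<in> F"
      using deriv_on_extend[OF A x(2) F(3)[OF x(1)], of "\<lambda>_. 0" F 1] F(1,2) x(1)
        subfield_closed(1,2)[OF F(1)] by auto
    have "P (adjoin CHAR('a) A x) D"
      unfolding P_def using D subfield_adjoin_char[OF A F(3)[OF x(1)]] adjoin_least[OF F(1,2) x(1)] by blast
    then show ?case by blast
  next
    case (insert s S)
    then obtain M D where MD: "P M D" "S \<subseteq> M" by auto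
    have s: "s \<in> F" "s ^ CHAR('a) \<in> A" using insert.prems F(3) by auto
    show ?case
    proof (cases "s \<in> M")
      case True
      then show ?thesis using MD by auto
    next
      case False
      let ?N = "adjoin CHAR('a) M s"
      have M: "subfield M" "A \<subseteq> M" "x \<in> M" "M \<subseteq> F" "deriv_on M D" "\<forall>a\<in>A. D a = 0" "D x = 1"
        "\<And>y. y \<in> M \<Longrightarrow> D y \<in> F"
        using MD(1) unfolding P_def by auto
      have sM: "s ^ CHAR('a) \<in> M" "D (s ^ CHAR('a)) = 0" using s M by auto
      obtain D' where D': "deriv_on ?N D'" "\<forall>y\<in>M. D' y = D y" "\<forall>y\<in>?N. D' y \<in> F"
        using deriv_on_extend[OF M(1) False sM(1) M(5) sM(2) F(1) M(4) M(8) s(1) subfield_closed(1)[OF F(1)]]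
        by blast
      have "P ?N D'"
        unfolding P_def using D' M subfield_adjoin_char[OF M(1) sM(1)] adjoin_least[OF F(1) M(4) s(1)]
        by (auto simp: subset_iff)
      moreover have "insert s S \<subseteq> ?N" using subfield_adjoin_char(2,3)[OF M(1) sM(1)] MD(2) by auto
      ultimately show ?thesis by blast
    qed
  qed
  then obtain M D where MD: "P M D" "S \<subseteq> M" by auto
  have "gen_field (A \<union> S) \<subseteq> M" using MD by (intro gen_field_least) (auto simp: P_def)
  then have "M = F" using S(3) MD(1) by (auto simp: P_def)
  then have D: "deriv_on F D" "\<forall>a\<in>A. D a = 0" "D x = 1" "\<forall>y\<in>F. D y \<in> F"
    using MD(1) by (auto simp: P_def)
  \<comment> \<open>Derivations are represented with value 0 outside \<open>F\<close>, so the result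
    is cut off there.\<close>
  let ?E = "\<lambda>y. if y \<in> F then D y else 0"
  have "deriv_on F ?E"
    using D(1) subfield_closed(3,4)[OF F(1)] by (simp add: deriv_on_def)
  then have "?E \<in> RelDer F A" using D(2,4) F(2) by (auto simp: RelDer_def derivation_alt)
  then show ?thesis using D(3) x(1) by (intro bexI[of _ ?E]) auto
qed

lemma Ann_RelDer:
  fixes A F :: "'a set"
  assumes "subfield A" "subfield F" "A \<subseteq> F" "\<And>y. y \<in> F \<Longrightarrow> y ^ CHAR('a) \<in> A"
    and "finite S" "S \<subseteq> F" "F \<subseteq> gen_field (A \<union> S)"
  shows "Ann F (RelDer F A) = A"
proof -
  have "\<forall>x\<in>F - A. \<exists>D \<in> RelDer F A. D x \<noteq> 0" using ex_derivation_neq_0[OF assms] by blast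
  then show ?thesis using assms(3) unfolding Ann_def RelDer_def by blast
qed

end

section \<open>Jacobson's correspondence in height one\<close>

lemma sum_lessThan_times:
  fixes g :: "nat \<Rightarrow> 'b::comm_monoid_add"
  shows "(\<Sum>k<n * m. g k) = (\<Sum>q<n. \<Sum>r<m. g (q * m + r))"
proof -
  have "(\<Sum>r<m. g (q * m + r)) = sum g {q * m..<q * m + m}" for q
    using sum.atLeastLessThan_shift_0[of g "q * m" "q * m + m"] by (simp add: atLeast0LessThan)
  then show ?thesis using sum.nat_group[of g m n] by simp
qed

lemma ext_has_dim_trans:
  assumes A: "subfield B" "A \<subseteq> B" and BC: "subfield C" "B \<subseteq> C"
    and m: "ext_has_dim A B m" and n: "ext_has_dim B C n"
  shows "ext_has_dim A C (m * n)"
proof -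
  obtain b where b: "\<forall>i<m. b i \<in> B"
      "\<And>c. (\<forall>i<m. c i \<in> A) \<Longrightarrow> (\<Sum>i<m. c i * b i) = 0 \<Longrightarrow> \<forall>i<m. c i = 0"
      "\<And>x. x \<in> B \<Longrightarrow> \<exists>c. (\<forall>i<m. c i \<in> A) \<and> x = (\<Sum>i<m. c i * b i)"
    using m unfolding ext_has_dim_def by blast
  obtain d where d: "\<forall>i<n. d i \<in> C"
      "\<And>c. (\<forall>i<n. c i \<in> B) \<Longrightarrow> (\<Sum>i<n. c i * d i) = 0 \<Longrightarrow> \<forall>i<n. c i = 0"
      "\<And>x. x \<in> C \<Longrightarrow> \<exists>c. (\<forall>i<n. c i \<in> B) \<and> x = (\<Sum>i<n. c i * d i)"
    using n unfolding ext_has_dim_def by blast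
  \<comment> \<open>The product basis is enumerated by \<open>k = q * m + r\<close>, with
    \<open>r\<close> indexing the lower basis and \<open>q\<close> the upper one.\<close>
  define e where "e k = b (k mod m) * d (k div m)" for k
  have sum_e: "(\<Sum>k<m * n. c k * e k) = (\<Sum>q<n. (\<Sum>r<m. c (q * m + r) * b r) * d q)" for c
    unfolding mult.commute[of m n] sum_lessThan_times sum_distrib_right
    by (intro sum.cong refl) (simp add: e_def mult.assoc)
  have lt: "q * m + r < m * n" if "q < n" "r < m" for q r
  proof -
    have "q * m + r < Suc q * m" using that by simp
    also have "\<dots> \<le> n * m" using that by (intro mult_le_mono1) simp
    finally show ?thesis by (simp add: mult.commute)
  qed
  have div_lt: "k div m < n" "k mod m < m" if "k < m * n" for k
  proof -
    show "k div m < n" using that by (metis less_mult_imp_div_less mult.commute)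
    show "k mod m < m" using that by (cases "m = 0") auto
  qed
  show ?thesis
    unfolding ext_has_dim_def
  proof (rule exI[of _ e], intro conjI allI impI ballI)
    fix k assume "k < m * n"
    then show "e k \<in> C" unfolding e_def using div_lt[of k] b(1) d(1) BC by (blast intro: subfield_closed(4))
  next
    fix c k assume c: "\<forall>i<m * n. c i \<in> A" "(\<Sum>k<m * n. c k * e k) = 0" and k: "k < m * n"
    have "\<forall>q<n. (\<Sum>r<m. c (q * m + r) * b r) = 0"
    proof (rule d(2))
      show "\<forall>q<n. (\<Sum>r<m. c (q * m + r) * b r) \<in> B"
        using lt c(1) b(1) A(2) by (intro allI impI subfield_sum[OF A(1)] subfield_closed(4)[OF A(1)]) auto
    qed (use c(2) sum_e in simp)
    then have "\<forall>r<m. c (k div m * m + r) = 0"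
      using lt c(1) div_lt(1)[OF k] by (intro b(2)) auto
    then have "c (k div m * m + k mod m) = 0" using div_lt(2)[OF k] by blast
    then show "c k = 0" by simp
  next
    fix x assume "x \<in> C"
    then obtain f where f: "\<forall>q<n. f q \<in> B" "x = (\<Sum>q<n. f q * d q)" using d(3) by blast
    have "\<forall>q. \<exists>c. q < n \<longrightarrow> (\<forall>r<m. c r \<in> A) \<and> f q = (\<Sum>r<m. c r * b r)" using f(1) b(3) by blast
    then obtain g where g: "\<And>q. q < n \<Longrightarrow> (\<forall>r<m. g q r \<in> A) \<and> f q = (\<Sum>r<m. g q r * b r)" by metis
    define c where "c k = g (k div m) (k mod m)" for k
    have "x = (\<Sum>k<m * n. c k * e k)"
      unfolding sum_e f(2) using g by (intro sum.cong refl) (simp add: c_def)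
    moreover have "\<forall>k<m * n. c k \<in> A" unfolding c_def using g div_lt by blast
    ultimately show "\<exists>c. (\<forall>k<m * n. c k \<in> A) \<and> x = (\<Sum>k<m * n. c k * e k)" by blast
  qed
qed

text \<open>For a nilpotent derivation \<open>D\<close> with \<open>D x = 1\<close>, the truncated Taylor expansion in \<open>x\<close> has
  coefficients in the kernel of \<open>D\<close>.\<close>

context
  assumes char_pos: "CHAR('a::field) > 0"
begin

lemma deriv_on_taylor_sum:
  fixes G :: "'a set"
  assumes G: "subfield G" and D: "deriv_on G D" and x: "x \<in> G" "D x = 1"
    and c: "\<And>i. i < n \<Longrightarrow> c i \<in> G \<and> D (c i) = 0"
  shows "D (\<Sum>i<n. c i * x ^ i) = (\<Sum>i<n. c i * (of_nat i * x ^ (i - 1)))"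
  using c
proof (induction n)
  case 0
  then show ?case using deriv_onD(3)[OF D G] by simp
next
  case (Suc n)
  have mem: "(\<Sum>i<n. c i * x ^ i) \<in> G" "c n * x ^ n \<in> G" "x ^ n \<in> G"
    using Suc.prems x(1)
    by (intro subfield_sum[OF G] subfield_closed(4)[OF G] subfield_power[OF G]; simp)+
  have "D (c n * x ^ n) = c n * (of_nat n * x ^ (n - 1))"
    using deriv_onD(2)[OF D G _ mem(3)] deriv_onD(7)[OF D G x(1)] Suc.prems[of n] x(2) by simp
  then show ?case using deriv_onD(1)[OF D G mem(1,2)] Suc by simp
qed

text \<open>Applying \<open>D\<close> to a relation lowers its degree and multiplies the
  coefficients by integers below \<open>p\<close>, which are invertible.\<close>

lemma taylor_independent:
  fixes G :: "'a set"
  assumes G: "subfield G" and D: "deriv_on G D" and x: "x \<in> G" "D x = 1"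
    and c: "\<And>i. i < n \<Longrightarrow> c i \<in> G \<and> D (c i) = 0" and n: "n \<le> CHAR('a)"
    and zero: "(\<Sum>i<n. c i * x ^ i) = 0"
  shows "\<forall>i<n. c i = 0"
  using c n zero
proof (induction n arbitrary: c)
  case (Suc n)
  note dD = deriv_onD[OF D G]
  have "0 = D (\<Sum>i<Suc n. c i * x ^ i)" using Suc.prems(3) dD(3) by simp
  also have "\<dots> = (\<Sum>i<Suc n. c i * (of_nat i * x ^ (i - 1)))"
    by (rule deriv_on_taylor_sum[OF G D x Suc.prems(1)])
  also have "\<dots> = (\<Sum>i<n. (of_nat (Suc i) * c (Suc i)) * x ^ i)"
    unfolding sum.lessThan_Suc_shift by (simp add: mult_ac del: of_nat_Suc)
  finally have sum0: "(\<Sum>i<n. (of_nat (Suc i) * c (Suc i)) * x ^ i) = 0" by simp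
  have "of_nat (Suc i) * c (Suc i) \<in> G \<and> D (of_nat (Suc i) * c (Suc i)) = 0" if "i < n" for i
  proof -
    have K: "subfield {y \<in> G. D y = 0}" by (rule subfield_kernel[OF G D])
    show ?thesis
      using subfield_closed(4)[OF K subfield_of_nat[OF K]] Suc.prems(1)[of "Suc i"] that by blast
  qed
  then have "\<forall>i<n. of_nat (Suc i) * c (Suc i) = 0"
    by (intro Suc.IH) (use Suc.prems(2) sum0 in auto)
  moreover have "(of_nat (Suc i) :: 'a) \<noteq> 0" if "i < n" for i
    using of_nat_less_char_neq_0[OF char_pos, of "Suc i"] Suc.prems(2) that by simp
  ultimately have tail: "c (Suc i) = 0" if "i < n" for i using that by (metis mult_eq_0_iff)
  then have "(\<Sum>i<Suc n. c i * x ^ i) = c 0"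
    unfolding sum.lessThan_Suc_shift by simp
  then show ?case using Suc.prems(3) tail by (auto simp: less_Suc_eq_0_disj)
qed simp

text \<open>The expansion of \<open>D y\<close>, one term shorter, is integrated term by term; the
  denominators stay below \<open>p\<close>, and the error is a constant for
  \<open>D\<close>.\<close>

lemma taylor_expansion:
  fixes G :: "'a set"
  assumes G: "subfield G" and D: "deriv_on G D" "\<And>y. y \<in> G \<Longrightarrow> D y \<in> G" and x: "x \<in> G" "D x = 1"
    and y: "y \<in> G" "(D ^^ n) y = 0" and n: "n \<le> CHAR('a)"
  shows "\<exists>c. (\<forall>i<n. c i \<in> G \<and> D (c i) = 0) \<and> y = (\<Sum>i<n. c i * x ^ i)"
  using y n
proof (induction n arbitrary: y)
  case (Suc n)
  have K: "subfield {y \<in> G. D y = 0}" by (rule subfield_kernel[OF G D(1)])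
  have "(D ^^ n) (D y) = 0" using Suc.prems(2) by (simp add: funpow_swap1)
  then obtain c where c: "\<forall>i<n. c i \<in> G \<and> D (c i) = 0" "D y = (\<Sum>i<n. c i * x ^ i)"
    using Suc.IH[of "D y"] D(2) Suc.prems by auto
  define d where "d i = c i / of_nat (Suc i)" for i
  have dK: "d i \<in> G \<and> D (d i) = 0" if "i < n" for i
  proof -
    have "d i \<in> {y \<in> G. D y = 0}"
      unfolding d_def using c(1) that by (intro subfield_closed(8)[OF K] subfield_of_nat[OF K]) auto
    then show ?thesis by simp
  qed
  \<comment> \<open>The antiderivative \<open>z\<close> has constant term 0; that slot is filled at
    the end by \<open>y - z\<close>.\<close>
  define e where "e i = (case i of 0 \<Rightarrow> 0 | Suc j \<Rightarrow> d j)" for i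
  have eK: "e i \<in> G \<and> D (e i) = 0" if "i < Suc n" for i
    using dK that subfield_closed(1)[OF K] by (auto simp: e_def split: nat.split)
  define z where "z = (\<Sum>i<Suc n. e i * x ^ i)"
  have zG: "z \<in> G"
    unfolding z_def using eK x(1) by (intro subfield_sum[OF G] subfield_closed(4)[OF G] subfield_power[OF G]) auto
  have "D z = (\<Sum>i<Suc n. e i * (of_nat i * x ^ (i - 1)))"
    unfolding z_def by (rule deriv_on_taylor_sum[OF G D(1) x]) (rule eK)
  also have "\<dots> = (\<Sum>i<n. d i * (of_nat (Suc i) * x ^ i))"
    unfolding sum.lessThan_Suc_shift by (simp add: e_def)
  also have "\<dots> = D y"
    unfolding c(2)
  proof (intro sum.cong refl)
    fix i assume "i \<in> {..<n}"
    then have "(of_nat (Suc i) :: 'a) \<noteq> 0"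
      using of_nat_less_char_neq_0[OF char_pos, of "Suc i"] Suc.prems(3) by simp
    then show "d i * (of_nat (Suc i) * x ^ i) = c i * x ^ i"
      by (simp add: d_def del: of_nat_Suc)
  qed
  finally have "D (y - z) = 0" using deriv_onD(6)[OF D(1) G Suc.prems(1) zG] by simp
  moreover have "y - z \<in> G" using subfield_closed(7)[OF G Suc.prems(1) zG] .
  moreover have "y = (\<Sum>i<Suc n. (e(0 := y - z)) i * x ^ i)"
  proof -
    have "z = (\<Sum>i<n. d i * x ^ Suc i)"
      unfolding z_def sum.lessThan_Suc_shift by (simp add: e_def)
    then show ?thesis unfolding sum.lessThan_Suc_shift by (simp add: e_def)
  qed
  ultimately show ?case using eK by (intro exI[of _ "e(0 := y - z)"]) auto
qed simp

lemma ext_has_dim_kernel: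
  fixes G :: "'a set"
  assumes G: "subfield G" and D: "deriv_on G D" "\<And>y. y \<in> G \<Longrightarrow> D y \<in> G" and x: "x \<in> G" "D x = 1"
    and nil: "\<And>y. y \<in> G \<Longrightarrow> (D ^^ CHAR('a)) y = 0"
  shows "ext_has_dim {y \<in> G. D y = 0} G CHAR('a)"
  unfolding ext_has_dim_def
proof (rule exI[of _ "\<lambda>i. x ^ i"], intro conjI allI impI ballI)
  show "x ^ i \<in> G" for i by (rule subfield_power[OF G x(1)])
next
  fix c i assume "\<forall>i<CHAR('a). c i \<in> {y \<in> G. D y = 0}" "(\<Sum>i<CHAR('a). c i * x ^ i) = 0" "i < CHAR('a)"
  then show "c i = 0" using taylor_independent[OF G D(1) x _ order_refl] by blast
next
  fix y assume "y \<in> G"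
  then show "\<exists>c. (\<forall>i<CHAR('a). c i \<in> {y \<in> G. D y = 0}) \<and> y = (\<Sum>i<CHAR('a). c i * x ^ i)"
    using taylor_expansion[OF G D x _ nil order_refl] by blast
qed

text \<open>Imposing the conditions \<open>D i y = 0\<close> one after another gives a descending
  chain of kernels. Each step has degree \<open>p\<close>, with the powers of one \<open>x m\<close>
  as basis, by Taylor expansion.\<close>

lemma commuting_dual_system:
  fixes F :: "'a set"
  assumes F: "subfield F" and D: "\<And>i. i < r \<Longrightarrow> deriv_on F (D i)" "\<And>i y. i < r \<Longrightarrow> y \<in> F \<Longrightarrow> D i y \<in> F"
    and x: "\<And>i. i < r \<Longrightarrow> x i \<in> F" "\<And>i j. i < r \<Longrightarrow> j < r \<Longrightarrow> D i (x j) = (if i = j then 1 else 0)"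
    and comm: "\<And>i j y. i < r \<Longrightarrow> j < r \<Longrightarrow> y \<in> F \<Longrightarrow> D i (D j y) = D j (D i y)"
    and nil: "\<And>i y. i < r \<Longrightarrow> y \<in> F \<Longrightarrow> (D i ^^ CHAR('a)) y = 0"
  shows "ext_has_dim {y \<in> F. \<forall>i<r. D i y = 0} F (CHAR('a) ^ r)
    \<and> (\<forall>M. subfield M \<longrightarrow> {y \<in> F. \<forall>i<r. D i y = 0} \<subseteq> M \<longrightarrow> x ` {..<r} \<subseteq> M \<longrightarrow> F \<subseteq> M)"
proof -
  define H where "H m = {y \<in> F. \<forall>i<m. D i y = 0}" for m
  have H: "subfield (H m)" if "m \<le> r" for m
    using that
  proof (induction m)
    case 0
    then show ?case using F by (simp add: H_def)
  next
    case (Suc m)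
    then have "deriv_on (H m) (D m)" by (intro deriv_on_subset[OF D(1)]) (auto simp: H_def)
    moreover have "H (Suc m) = {y \<in> H m. D m y = 0}" by (auto simp: H_def less_Suc_eq)
    ultimately show ?case using subfield_kernel Suc by auto
  qed
  have step: "ext_has_dim (H (Suc m)) (H m) CHAR('a)
      \<and> (\<forall>y\<in>H m. \<exists>c. (\<forall>i<CHAR('a). c i \<in> H (Suc m)) \<and> y = (\<Sum>i<CHAR('a). c i * x m ^ i))"
    if m: "m < r" for m
  proof -
    have eq: "H (Suc m) = {y \<in> H m. D m y = 0}" by (auto simp: H_def less_Suc_eq)
    have HF: "H m \<subseteq> F" by (auto simp: H_def)
    have d: "deriv_on (H m) (D m)" by (rule deriv_on_subset[OF D(1)[OF m] HF])
    have dm: "D m y \<in> H m" if "y \<in> H m" for y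
    proof -
      \<comment> \<open>Commutation keeps \<open>D m\<close> inside the common kernel of its
        predecessors.\<close>
      have "D i (D m y) = 0" if i: "i < m" for i
        using comm[of i m y] i m \<open>y \<in> H m\<close> deriv_onD(3)[OF D(1)[OF m] F] by (auto simp: H_def)
      then show ?thesis using D(2)[OF m] that by (auto simp: H_def)
    qed
    have xm: "x m \<in> H m" "D m (x m) = 1" using x m by (auto simp: H_def)
    have nm: "(D m ^^ CHAR('a)) y = 0" if "y \<in> H m" for y using nil[OF m] that HF by blast
    show ?thesis
      unfolding eq using ext_has_dim_kernel[OF H d dm xm nm] taylor_expansion[OF H d dm xm _ nm order_refl] m
      by auto
  qed
  have dim: "m \<le> r \<Longrightarrow> ext_has_dim (H m) F (CHAR('a) ^ m)" for m
  proof (induction m)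
    case 0
    have "\<exists>c. c (0::nat) \<in> F \<and> y = c 0" if "y \<in> F" for y using that by (intro exI[of _ "\<lambda>_. y"]) simp
    then have "ext_has_dim F F 1"
      unfolding ext_has_dim_def using subfield_closed(2)[OF F] by (intro exI[of _ "\<lambda>_. 1"]) simp
    then show ?case by (simp add: H_def)
  next
    case (Suc m)
    have "ext_has_dim (H (Suc m)) F (CHAR('a) * CHAR('a) ^ m)"
      proof (rule ext_has_dim_trans[OF H _ F])
      show "ext_has_dim (H (Suc m)) (H m) CHAR('a)" using step Suc.prems by simp
    qed (use Suc in \<open>auto simp: H_def\<close>)
    then show ?case by simp
  qed
  have "F \<subseteq> M" if M: "subfield M" "H r \<subseteq> M" "x ` {..<r} \<subseteq> M" for M
  proof -
    \<comment> \<open>Climbing from the common kernel \<open>H r\<close> to \<open>H 0 = F\<close>,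
      each level is obtained from the one below by a single \<open>x m\<close>.\<close>
    have "H (r - k) \<subseteq> M" if "k \<le> r" for k
      using that
    proof (induction k)
      case 0
      then show ?case using M(2) by simp
    next
      case (Suc k)
      define m where "m = r - Suc k"
      have m: "m < r" "Suc m = r - k" using Suc.prems by (auto simp: m_def)
      have "y \<in> M" if "y \<in> H m" for y
      proof -
        obtain c where c: "\<forall>i<CHAR('a). c i \<in> H (Suc m)" "y = (\<Sum>i<CHAR('a). c i * x m ^ i)"
          using step[OF m(1)] \<open>y \<in> H m\<close> by blast
        have "c i \<in> M" if "i < CHAR('a)" for i using c(1) that Suc m(2) by auto
        moreover have "x m \<in> M" using M(3) m(1) by auto
        ultimately show ?thesis
          unfolding c(2) by (intro subfield_sum[OF M(1)] subfield_closed(4)[OF M(1)] subfield_power[OF M(1)]) auto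
      qed
      then show ?case by (auto simp: m_def)
    qed
    from this[of r] show "F \<subseteq> M" by (simp add: H_def)
  qed
  then show ?thesis using dim[OF order_refl] unfolding H_def by blast
qed

end

section \<open>Dual bases for spaces of derivations\<close>

definition der_space :: "'a::field set \<Rightarrow> ('a \<Rightarrow> 'a) set \<Rightarrow> bool" where
  "der_space F L \<longleftrightarrow> L \<subseteq> Der F \<and> (\<lambda>x. 0) \<in> L \<and>
     (\<forall>D\<in>L. \<forall>E\<in>L. (\<lambda>x. D x + E x) \<in> L) \<and> (\<forall>c\<in>F. \<forall>D\<in>L. (\<lambda>x. c * D x) \<in> L)"

lemma der_spaceD:
  assumes "der_space F L"
  shows "(\<lambda>x. 0) \<in> L" "D \<in> L \<Longrightarrow> E \<in> L \<Longrightarrow> (\<lambda>x. D x + E x) \<in> L"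
    "c \<in> F \<Longrightarrow> D \<in> L \<Longrightarrow> (\<lambda>x. c * D x) \<in> L" "D \<in> L \<Longrightarrow> derivation F D"
  using assms by (auto simp: der_space_def Der_def)

lemma der_space_sum:
  assumes "der_space F L" "\<And>i. i < (n::nat) \<Longrightarrow> D i \<in> L" "\<And>i. i < n \<Longrightarrow> c i \<in> F"
  shows "(\<lambda>z. \<Sum>i<n. c i * D i z) \<in> L"
  using assms(2,3)
proof (induction n)
  case 0
  then show ?case using assms(1) by (simp add: der_space_def)
next
  case (Suc n)
  have "(\<lambda>z. c n * D n z) \<in> L" using assms(1) Suc.prems by (simp add: der_space_def)
  then show ?case
    using assms(1) Suc unfolding der_space_def by simp
qed

lemma der_space_diff:
  assumes "subfield F" "der_space F L" "D \<in> L" "E \<in> L"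
  shows "(\<lambda>z. D z - E z) \<in> L"
  using der_spaceD(2)[OF assms(2,3) der_spaceD(3)[OF assms(2) _ assms(4), of "- 1"]]
    subfield_closed(2,5)[OF assms(1)] by simp

text \<open>The \<open>D i\<close> form a basis of \<open>L\<close> whose coordinate functionals are
  the evaluations at the \<open>x i\<close>.\<close>

definition dual_system :: "('a::field \<Rightarrow> 'a) set \<Rightarrow> nat \<Rightarrow> (nat \<Rightarrow> 'a \<Rightarrow> 'a) \<Rightarrow> (nat \<Rightarrow> 'a) \<Rightarrow> bool" where
  "dual_system L r D x \<longleftrightarrow> (\<forall>i<r. D i \<in> L) \<and> (\<forall>i<r. \<forall>j<r. D i (x j) = (if i = j then 1 else 0)) \<and>
     (\<forall>E\<in>L. E = (\<lambda>z. \<Sum>i<r. E (x i) * D i z))"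

text \<open>Gaussian elimination on evaluations: the derivations killing \<open>t\<close> are
  treated by induction, and at most one further basis element, normalised at \<open>t\<close>, is
  added. The bound on \<open>r\<close> later controls the ranks.\<close>

lemma ex_dual_system:
  assumes F: "subfield F" and L: "der_space F L" and ts: "set ts \<subseteq> F"
    and det: "\<And>D. D \<in> L \<Longrightarrow> \<forall>t\<in>set ts. D t = 0 \<Longrightarrow> D = (\<lambda>x. 0)"
  shows "\<exists>r D x. r \<le> length ts \<and> x ` {..<r} \<subseteq> set ts \<and> dual_system L r D x"
  using L ts det
proof (induction ts arbitrary: L)
  case Nil
  have "E = (\<lambda>x. 0)" if "E \<in> L" for E using Nil.prems(3)[OF that] by simp
  then show ?case by (intro exI[of _ 0]) (auto simp: dual_system_def)
next
  case (Cons t ts)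
  define L' where "L' = {D \<in> L. D t = 0}"
  have "der_space F L'" using Cons.prems(1) unfolding L'_def der_space_def by auto
  moreover have "D = (\<lambda>x. 0)" if "D \<in> L'" "\<forall>t\<in>set ts. D t = 0" for D
    using Cons.prems(3)[of D] that by (auto simp: L'_def)
  ultimately obtain r D x where r: "r \<le> length ts" "x ` {..<r} \<subseteq> set ts" "dual_system L' r D x"
    using Cons.IH[of L'] Cons.prems(2) by auto
  note dual = r(3)[unfolded dual_system_def]
  have D: "D i \<in> L" "D i t = 0" if "i < r" for i using dual that by (auto simp: L'_def)
  show ?case
  proof (cases "L' = L")
    case True
    then show ?thesis using r by (intro exI[of _ r] exI[of _ D] exI[of _ x]) auto
  next
    case False
    then obtain E where E: "E \<in> L" "E t \<noteq> 0" by (auto simp: L'_def)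
    have xF: "x i \<in> F" if "i < r" for i using Cons.prems(2) r(2) that by auto
    have "t \<in> F" using Cons.prems(2) by simp
    then have EtF: "inverse (E t) \<in> F"
      using E(1) Cons.prems(1) by (auto simp: der_space_def Der_def derivation_alt intro: subfield_closed(6)[OF F])
    define E1 where "E1 = (\<lambda>z. inverse (E t) * E z)"
    have E1: "E1 \<in> L" "E1 t = 1"
      using E der_spaceD(3)[OF Cons.prems(1) EtF E(1)] by (auto simp: E1_def)
    have E1x: "E1 (x i) \<in> F" if "i < r" for i
      using E1(1) Cons.prems(1) xF[OF that] by (auto simp: der_space_def Der_def derivation_alt)
    \<comment> \<open>Subtracting the earlier components makes the new derivation vanish at the
      earlier \<open>x i\<close>; its value at \<open>t\<close> is unaffected because the
      \<open>D i\<close> vanish there.\<close>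
    define E2 where "E2 = (\<lambda>z. E1 z - (\<Sum>i<r. E1 (x i) * D i z))"
    have E2: "E2 \<in> L"
      unfolding E2_def
      by (rule der_space_diff[OF F Cons.prems(1) E1(1) der_space_sum[OF Cons.prems(1) D(1) E1x]])
    have E2t: "E2 t = 1" unfolding E2_def using D(2) E1(2) by simp
    have E2x: "E2 (x j) = 0" if "j < r" for j
    proof -
      have "(\<Sum>i<r. E1 (x i) * D i (x j)) = (\<Sum>i<r. if i = j then E1 (x i) else 0)"
        using dual that by (intro sum.cong) auto
      then show ?thesis using that by (simp add: E2_def)
    qed
    let ?D = "D(r := E2)" and ?x = "x(r := t)"
    have "E' = (\<lambda>z. \<Sum>i<Suc r. E' (?x i) * ?D i z)" if E': "E' \<in> L" for E'
    proof -
      have Et: "E' t \<in> F" using E' Cons.prems(1) \<open>t \<in> F\<close> by (auto simp: der_space_def Der_def derivation_alt)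
      define G where "G = (\<lambda>z. E' z - E' t * E2 z)"
      have "G \<in> L"
        unfolding G_def by (rule der_space_diff[OF F Cons.prems(1) E' der_spaceD(3)[OF Cons.prems(1) Et E2]])
      then have "G \<in> L'" using E2t by (simp add: L'_def G_def)
      then have "G = (\<lambda>z. \<Sum>i<r. G (x i) * D i z)" using dual by blast
      moreover have "(\<Sum>i<r. G (x i) * D i z) = (\<Sum>i<r. E' (x i) * D i z)" for z
        using E2x by (intro sum.cong) (auto simp: G_def)
      ultimately have "G z = (\<Sum>i<r. E' (x i) * D i z)" for z by metis
      then have *: "E' z = (\<Sum>i<r. E' (x i) * D i z) + E' t * E2 z" for z
        unfolding G_def diff_eq_eq .
      show ?thesis
      proof
        fix z
        have "(\<Sum>i<r. E' (?x i) * ?D i z) = (\<Sum>i<r. E' (x i) * D i z)" by (intro sum.cong) auto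
        then show "E' z = (\<Sum>i<Suc r. E' (?x i) * ?D i z)" using *[of z] by simp
      qed
    qed
    moreover have "\<forall>i<Suc r. \<forall>j<Suc r. ?D i (?x j) = (if i = j then 1 else 0)"
      using dual D(2) E2t E2x by (auto simp: less_Suc_eq)
    moreover have "\<forall>i<Suc r. ?D i \<in> L" using D(1) E2 by (auto simp: less_Suc_eq)
    ultimately have "dual_system L (Suc r) ?D ?x" unfolding dual_system_def by blast
    moreover have "?x ` {..<Suc r} \<subseteq> set (t # ts)"
    proof
      fix y assume "y \<in> ?x ` {..<Suc r}"
      then obtain i where "i < Suc r" "y = ?x i" by blast
      moreover from this(1) have "i = r \<or> x i \<in> set ts" using r(2) by (auto simp: less_Suc_eq)
      ultimately show "y \<in> set (t # ts)" by auto
    qed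
    moreover have "Suc r \<le> length (t # ts)" using r(1) by simp
    ultimately show ?thesis by blast
  qed
qed

lemma dual_system_eq_zero:
  assumes "dual_system L r D x" "E \<in> L" "\<And>i. i < r \<Longrightarrow> E (x i) = 0"
  shows "E = (\<lambda>z. 0)"
proof -
  have "E = (\<lambda>z. \<Sum>i<r. E (x i) * D i z)" using assms(1,2) unfolding dual_system_def by blast
  moreover have "(\<Sum>i<r. E (x i) * D i z) = 0" for z using assms(3) by simp
  ultimately show ?thesis by metis
qed

lemma p_lie_imp_der_space: "p_lie F L \<Longrightarrow> der_space F L"
  unfolding p_lie_def der_space_def by blast

section \<open>Structure of finitely determined \<open>p\<close>-Lie algebras\<close>

context
  assumes char_pos: "CHAR('a::field) > 0"
begin

text \<open>A dual system chosen among \<open>ts\<close> has commuting members with vanishing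
  \<open>p\<close>-th powers, so the Taylor basis gives the degree and its generators determine
  every derivation over the annihilator. The list \<open>xs\<close> is kept because its
  \<open>p\<close>-th powers serve as test elements one level up.\<close>

theorem p_lie_structure:
  fixes F :: "'a set"
  assumes F: "subfield F" and L: "p_lie F L" and ts: "set ts \<subseteq> F"
    and det: "\<And>D. D \<in> L \<Longrightarrow> \<forall>t\<in>set ts. D t = 0 \<Longrightarrow> D = (\<lambda>x. 0)"
  shows "\<exists>xs. length xs \<le> length ts \<and> set xs \<subseteq> F \<and> der_has_dim F L (length xs)
      \<and> ext_has_dim (Ann F L) F (CHAR('a) ^ length xs)
      \<and> (\<forall>M. subfield M \<longrightarrow> Ann F L \<subseteq> M \<longrightarrow> set xs \<subseteq> M \<longrightarrow> F \<subseteq> M)"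
    and "subfield (Ann F L)" and "L = RelDer F (Ann F L)"
proof -
  note V = p_lie_imp_der_space[OF L]
  obtain r D x where r: "r \<le> length ts" "x ` {..<r} \<subseteq> set ts" "dual_system L r D x"
    using ex_dual_system[OF F V ts det] by blast
  note dual = r(3)[unfolded dual_system_def]
  have xF: "x i \<in> F" if "i < r" for i using that r(2) ts by auto
  have der: "deriv_on F E" "y \<in> F \<Longrightarrow> E y \<in> F" if "E \<in> L" for E y
    using that V by (auto simp: der_space_def Der_def derivation_alt)
  have DL: "D i \<in> L" if "i < r" for i using dual that by blast
  have Dx: "D i (x j) = (if i = j then 1 else 0)" if "i < r" "j < r" for i j using dual that by blast
  \<comment> \<open>All values \<open>D i (x j)\<close> are 0 or 1 and so are killed by every
    \<open>D i\<close>; this is why brackets and \<open>p\<close>-th powers vanish at the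
    \<open>x j\<close>.\<close>
  have const: "D i (if b then 1 else 0) = 0" if "i < r" for i b
    using deriv_onD(3,4)[OF der(1)[OF DL[OF that]] F] by simp
  have comm: "D i (D j y) = D j (D i y)" if ij: "i < r" "j < r" for i j y
  proof -
    have "(\<lambda>y. D i (D j y) - D j (D i y)) \<in> L"
      using L DL[OF ij(1)] DL[OF ij(2)] unfolding p_lie_def by simp
    then have "(\<lambda>y. D i (D j y) - D j (D i y)) = (\<lambda>z. 0)"
      by (rule dual_system_eq_zero[OF r(3)]) (simp add: Dx ij const)
    from fun_cong[OF this, of y] show ?thesis by simp
  qed
  have nil: "(D i ^^ CHAR('a)) y = 0" if i: "i < r" for i y
  proof -
    \<comment> \<open>Two applications of \<open>D i\<close> already kill each \<open>x j\<close>,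
      and a \<open>p\<close>-th power contains at least two.\<close>
    have "2 \<le> CHAR('a)" using prime_ge_2_nat[OF prime_char[OF char_pos]] .
    then obtain n where n: "CHAR('a) = Suc (Suc n)" by (metis Suc_le_D numeral_2_eq_2 Suc_le_mono)
    have z: "(D i ^^ k) 0 = 0" for k
      using deriv_onD(3)[OF der(1)[OF DL[OF i]] F] by (induction k) auto
    have "(D i ^^ CHAR('a)) \<in> L" using L DL[OF i] unfolding p_lie_def by blast
    then have "(D i ^^ CHAR('a)) = (\<lambda>z. 0)"
    proof (rule dual_system_eq_zero[OF r(3)])
      fix j assume j: "j < r"
      have "(D i ^^ Suc (Suc n)) (x j) = (D i ^^ n) (D i (D i (x j)))"
        by (simp add: funpow_swap1)
      then show "(D i ^^ CHAR('a)) (x j) = 0" using z const[OF i] Dx[OF i j] n by simp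
    qed
    then show ?thesis by simp
  qed
  have Ann: "Ann F L = {y \<in> F. \<forall>i<r. D i y = 0}"
  proof -
    have "E y = 0" if "\<forall>i<r. D i y = 0" "E \<in> L" for E y
    proof -
      have "E = (\<lambda>z. \<Sum>i<r. E (x i) * D i z)" using dual that(2) by blast
      then have "E y = (\<Sum>i<r. E (x i) * D i y)" by metis
      then show ?thesis using that(1) by simp
    qed
    then show ?thesis unfolding Ann_def using DL by blast
  qed
  note sys = commuting_dual_system[OF char_pos F der(1)[OF DL] der(2)[OF DL] xF Dx comm nil]
  let ?xs = "map x [0..<r]"
  have dim: "der_has_dim F L r"
    unfolding der_has_dim_def
  proof (rule exI[of _ D], intro conjI allI impI ballI DL)
    fix c j assume c: "(\<lambda>z. \<Sum>i<r. c i * D i z) = (\<lambda>z. 0)" and j: "j < r"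
    have "(\<Sum>i<r. c i * D i (x j)) = (\<Sum>i<r. if i = j then c i else 0)"
      using Dx j by (intro sum.cong) auto
    then show "c j = 0" using fun_cong[OF c, of "x j"] j by simp
  next
    fix E assume E: "E \<in> L"
    show "\<exists>c. (\<forall>i<r. c i \<in> F) \<and> E = (\<lambda>z. \<Sum>i<r. c i * D i z)"
      using dual E der(2)[OF E] xF by (intro exI[of _ "\<lambda>i. E (x i)"]) blast
  qed
  have gen: "F \<subseteq> M" if "subfield M" "Ann F L \<subseteq> M" "x ` {..<r} \<subseteq> M" for M
    using sys that unfolding Ann by blast
  show "\<exists>xs. length xs \<le> length ts \<and> set xs \<subseteq> F \<and> der_has_dim F L (length xs)
      \<and> ext_has_dim (Ann F L) F (CHAR('a) ^ length xs)
      \<and> (\<forall>M. subfield M \<longrightarrow> Ann F L \<subseteq> M \<longrightarrow> set xs \<subseteq> M \<longrightarrow> F \<subseteq> M)"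
    using r(1) xF dim sys unfolding Ann
    by (intro exI[of _ ?xs]) (auto simp: atLeast0LessThan)
  show sub: "subfield (Ann F L)"
  proof -
    have "Ann F L = F \<inter> (\<Inter>E\<in>L. {y \<in> F. E y = 0})" by (auto simp: Ann_def)
    moreover have "subfield {y \<in> F. E y = 0}" if "E \<in> L" for E
      by (rule subfield_kernel[OF F der(1)[OF that]])
    ultimately show ?thesis using F unfolding subfield_def by auto
  qed
  show "L = RelDer F (Ann F L)"
  proof
    show "L \<subseteq> RelDer F (Ann F L)"
      using V by (auto simp: RelDer_def Ann_def der_space_def Der_def)
    show "RelDer F (Ann F L) \<subseteq> L"
    proof
      fix E assume E: "E \<in> RelDer F (Ann F L)"
      then have dE: "derivation F E" "\<And>a. a \<in> Ann F L \<Longrightarrow> E a = 0" by (auto simp: RelDer_def)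
      \<comment> \<open>The candidate expansion of \<open>E\<close>: it agrees with \<open>E\<close>
        on the annihilator and at the \<open>x i\<close>, which together generate
        \<open>F\<close>.\<close>
      define G where "G = (\<lambda>z. \<Sum>i<r. E (x i) * D i z)"
      have G: "G \<in> L"
        unfolding G_def
        by (rule der_space_sum[OF V DL]) (use dE(1) xF in \<open>auto simp: derivation_alt\<close>)
      then have dG: "derivation F G" using V by (auto simp: der_space_def Der_def)
      have "E = G"
      proof (rule derivation_eqI[OF F dE(1) dG, of "Ann F L" "x ` {..<r}"])
        show "F \<subseteq> M" if "subfield M" "Ann F L \<subseteq> M" "x ` {..<r} \<subseteq> M" for M by (rule gen[OF that])
        show "Ann F L \<subseteq> F" "x ` {..<r} \<subseteq> F" using xF by (auto simp: Ann_def)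
        show "E a = G a" if "a \<in> Ann F L" for a using dE(2)[OF that] G that by (simp add: Ann_def)
        show "E s = G s" if "s \<in> x ` {..<r}" for s
        proof -
          obtain j where j: "j < r" "s = x j" using \<open>s \<in> _\<close> by auto
          have "G (x j) = (\<Sum>i<r. if i = j then E (x i) else 0)"
            unfolding G_def using Dx j by (intro sum.cong) auto
          then show ?thesis using j by simp
        qed
      qed
      then show "E \<in> L" using G by simp
    qed
  qed
qed

end

section \<open>Power towers and Jacobson sequences\<close>

context
  assumes char_pos: "CHAR('a::field) > 0"
begin

lemma ppow_field_Suc_rep: "(x :: 'a) \<in> ppow_field (Suc i) \<Longrightarrow> \<exists>y \<in> ppow_field i. x = y ^ CHAR('a)"
  using ppow_field_rep[of x i 1] by simp

text \<open>This transfers generation through Frobenius: a subfield containing the powers of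
  generators contains the powers of everything generated.\<close>

lemma subfield_frobenius_vimage:
  fixes M :: "'a set"
  assumes "subfield M"
  shows "subfield {y. y ^ (CHAR('a) ^ n) \<in> M}"
  unfolding subfield_def mem_Collect_eq
  using subfield_closed(1-6)[OF assms] char_pos
  by (simp add: frobenius_add[OF char_pos] frobenius_uminus[OF char_pos] power_mult_distrib
      power_inverse power_0_left)

lemma funpow_leibniz:
  fixes F :: "'a set"
  assumes F: "subfield F" and D: "derivation F D" and xy: "x \<in> F" "y \<in> F"
  shows "(D ^^ n) (x * y) = (\<Sum>k\<le>n. of_nat (n choose k) * ((D ^^ k) x * (D ^^ (n - k)) y))"
proof (induction n)
  case (Suc n)
  have d: "deriv_on F D" and DF: "\<And>z. z \<in> F \<Longrightarrow> D z \<in> F" using D by (auto simp: derivation_alt)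
  have mem: "(D ^^ k) z \<in> F" if "z \<in> F" for k z by (induction k) (use that DF in auto)
  have memp: "(D ^^ k) x * (D ^^ (n - k)) y \<in> F" for k using mem xy subfield_closed(4)[OF F] by blast
  note dD = deriv_onD[OF d F]
  have Dsum: "D (\<Sum>k\<in>I. f k) = (\<Sum>k\<in>I. D (f k))" if "\<And>k. k \<in> I \<Longrightarrow> f k \<in> F" for f :: "nat \<Rightarrow> 'a" and I
    using that
  proof (induction I rule: infinite_finite_induct)
    case (insert k I)
    then show ?case using dD(1)[of "f k" "sum f I"] subfield_sum[OF F, of I f] by simp
  qed (use dD(3) in auto)
  have Dnat: "D (of_nat m * z) = of_nat m * D z" if "z \<in> F" for m z
  proof (induction m)
    case (Suc m)
    then show ?case
      using dD(1)[OF that subfield_closed(4)[OF F subfield_of_nat[OF F, of m] that]] by (simp add: distrib_right)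
  qed (simp add: dD(3))
  let ?t = "\<lambda>k. (D ^^ k) x * (D ^^ (Suc n - k)) y"
  have "(D ^^ Suc n) (x * y) = (\<Sum>k\<le>n. of_nat (n choose k) * D ((D ^^ k) x * (D ^^ (n - k)) y))"
    using Suc Dsum[of "{..n}" "\<lambda>k. of_nat (n choose k) * ((D ^^ k) x * (D ^^ (n - k)) y)"]
      subfield_closed(4)[OF F subfield_of_nat[OF F] memp] by (simp add: Dnat[OF memp])
  also have "\<dots> = (\<Sum>k\<le>n. of_nat (n choose k) * ?t k + of_nat (n choose k) * ?t (Suc k))"
  proof (intro sum.cong refl)
    fix k assume "k \<in> {..n}"
    then have "Suc n - k = Suc (n - k)" by auto
    then show "of_nat (n choose k) * D ((D ^^ k) x * (D ^^ (n - k)) y)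
        = of_nat (n choose k) * ?t k + of_nat (n choose k) * ?t (Suc k)"
      using dD(2)[OF mem[OF xy(1)] mem[OF xy(2)], of k "n - k"] by (simp add: algebra_simps)
  qed
  also have "\<dots> = (\<Sum>k\<le>Suc n. of_nat (Suc n choose k) * ?t k)"
    unfolding sum_pascal sum.distrib ..
  finally show ?case .
qed simp

text \<open>In the iterated Leibniz rule the binomial coefficients strictly between the two ends are
  divisible by \<open>p\<close>.\<close>

lemma derivation_funpow_char:
  fixes F :: "'a set"
  assumes F: "subfield F" and D: "derivation F D"
  shows "derivation F (D ^^ CHAR('a))"
proof -
  let ?p = "CHAR('a)"
  have d: "deriv_on F D" and DF: "\<And>z. z \<in> F \<Longrightarrow> D z \<in> F" and D0: "\<And>z. z \<notin> F \<Longrightarrow> D z = 0"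
    using D by (auto simp: derivation_alt)
  note dD = deriv_onD[OF d F]
  have mem: "(D ^^ k) z \<in> F" if "z \<in> F" for k z by (induction k) (use that DF in auto)
  have z: "(D ^^ k) 0 = 0" for k by (induction k) (auto simp: dD(3))
  have "(D ^^ k) (x + y) = (D ^^ k) x + (D ^^ k) y" if "x \<in> F" "y \<in> F" for x y k
    by (induction k) (use dD(1) mem that in auto)
  moreover have "(D ^^ ?p) (x * y) = x * (D ^^ ?p) y + y * (D ^^ ?p) x" if xy: "x \<in> F" "y \<in> F" for x y
  proof -
    let ?f = "\<lambda>k. of_nat (?p choose k) * ((D ^^ k) x * (D ^^ (?p - k)) y)"
    have "(D ^^ ?p) (x * y) = sum ?f {..?p}" by (rule funpow_leibniz[OF F D xy])
    also have "\<dots> = sum ?f {0, ?p}"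
    proof (rule sum.mono_neutral_right)
      show "\<forall>k\<in>{..?p} - {0, ?p}. ?f k = 0"
      proof
        fix k assume "k \<in> {..?p} - {0, ?p}"
        then have "?p dvd (?p choose k)"
          using prime_char[OF char_pos] by (intro dvd_choose_prime) auto
        then have "of_nat (?p choose k) = (0 :: 'a)" using of_nat_eq_0_iff_char_dvd by blast
        then show "?f k = 0" by simp
      qed
    qed auto
    also have "\<dots> = x * (D ^^ ?p) y + y * (D ^^ ?p) x"
      using char_pos by (simp add: mult.commute)
    finally show ?thesis .
  qed
  moreover have "(D ^^ ?p) x = 0" if "x \<notin> F" for x
  proof -
    obtain n where "?p = Suc n" using char_pos by (metis gr0_implies_Suc)
    then show ?thesis using D0[OF that] z by (simp add: funpow_swap1)
  qed
  ultimately show ?thesis using mem unfolding derivation_def by blast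
qed

lemma p_lie_RelDer:
  fixes F :: "'a set"
  assumes F: "subfield F"
  shows "p_lie F (RelDer F A)"
proof -
  note cl = subfield_closed[OF F]
  have mem: "D \<in> RelDer F A \<longleftrightarrow> deriv_on F D \<and> (\<forall>x. x \<notin> F \<longrightarrow> D x = 0) \<and> (\<forall>x\<in>F. D x \<in> F) \<and> (\<forall>a\<in>A. D a = 0)" for D
    by (auto simp: RelDer_def derivation_alt)
  have "(\<lambda>x. 0) \<in> RelDer F A" unfolding mem using cl(1) by (simp add: deriv_on_def)
  moreover have "(\<lambda>x. D x + E x) \<in> RelDer F A" "(\<lambda>x. D (E x) - E (D x)) \<in> RelDer F A"
    if DE: "D \<in> RelDer F A" "E \<in> RelDer F A" for D E
  proof -
    have D: "deriv_on F D" "\<And>x. x \<notin> F \<Longrightarrow> D x = 0" "\<And>x. x \<in> F \<Longrightarrow> D x \<in> F" "\<And>a. a \<in> A \<Longrightarrow> D a = 0"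
      using DE(1) mem by auto
    have E: "deriv_on F E" "\<And>x. x \<notin> F \<Longrightarrow> E x = 0" "\<And>x. x \<in> F \<Longrightarrow> E x \<in> F" "\<And>a. a \<in> A \<Longrightarrow> E a = 0"
      using DE(2) mem by auto
    note d = deriv_onD(1-3)[OF D(1) F] deriv_onD(1-3)[OF E(1) F]
    show "(\<lambda>x. D x + E x) \<in> RelDer F A"
      unfolding mem using D(2-) E(2-) cl(3) by (simp add: deriv_on_def d algebra_simps)
    have "deriv_on F (\<lambda>x. D (E x) - E (D x))"
      using D(3) E(3) cl(3,4) by (simp add: deriv_on_def d algebra_simps)
    then show "(\<lambda>x. D (E x) - E (D x)) \<in> RelDer F A"
      unfolding mem using D(2-) E(2-) cl(7) by (simp add: d)
  qed
  moreover have "(\<lambda>x. c * D x) \<in> RelDer F A" if "c \<in> F" "D \<in> RelDer F A" for c D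
    using that cl(4) unfolding mem by (simp add: deriv_on_def algebra_simps)
  moreover have "D ^^ CHAR('a) \<in> RelDer F A" if D: "D \<in> RelDer F A" for D
  proof -
    have "derivation F D" "\<And>a. a \<in> A \<Longrightarrow> D a = 0" using D by (auto simp: RelDer_def)
    moreover have "(D ^^ k) 0 = 0" for k
      using deriv_onD(3)[of F D] D F mem by (induction k) auto
    moreover obtain n where "CHAR('a) = Suc n" using char_pos by (metis gr0_implies_Suc)
    ultimately show ?thesis
      using derivation_funpow_char[OF F, of D] by (simp add: RelDer_def funpow_swap1)
  qed
  ultimately show ?thesis unfolding p_lie_def by (simp add: RelDer_def Der_def subset_iff)
qed

text \<open>The level \<open>W i\<close> is generated by \<open>W (Suc i)\<close> and
  \<open>ppow_field i\<close>, and both have their \<open>p\<close>-th powers in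
  \<open>W (Suc i)\<close>.\<close>

lemma power_tower_char_power:
  fixes W :: "nat \<Rightarrow> 'a set"
  assumes W: "power_tower W" and y: "y \<in> W i"
  shows "y ^ CHAR('a) \<in> W (Suc i)"
proof -
  let ?Z = "{y. y ^ (CHAR('a) ^ 1) \<in> W (Suc i)}"
  have "compositum (W (Suc i)) (ppow_field i) \<subseteq> ?Z"
  proof (rule compositum_least)
    show "subfield ?Z" by (rule subfield_frobenius_vimage[OF power_towerD(1)[OF W]])
    show "W (Suc i) \<subseteq> ?Z" using subfield_power[OF power_towerD(1)[OF W]] by auto
    show "ppow_field i \<subseteq> ?Z" using ppow_field_power[of _ i 1] power_towerD(3)[OF W, of "Suc i"] by auto
  qed
  then show ?thesis using y power_towerD(2)[OF W, of i "Suc i"] by auto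
qed

lemma RelDer_Int_trivial:
  fixes F :: "'a set"
  assumes F: "subfield F" and D: "D \<in> RelDer F A" "D \<in> RelDer F B" and AB: "A \<subseteq> F" "B \<subseteq> F" "F \<subseteq> compositum A B"
  shows "D = (\<lambda>x. 0)"
proof (rule derivation_eqI[OF F, of _ _ A B])
  show "derivation F D" using D(1) by (simp add: RelDer_def)
  show "derivation F (\<lambda>x. 0)" using subfield_closed(1)[OF F] by (simp add: derivation_def)
  show "F \<subseteq> M" if "subfield M" "A \<subseteq> M" "B \<subseteq> M" for M using compositum_least[OF that] AB(3) by blast
qed (use D AB in \<open>auto simp: RelDer_def\<close>)

lemma power_tower_RelDer_Int:
  fixes W :: "nat \<Rightarrow> 'a set"
  assumes W: "power_tower W" and D: "D \<in> RelDer (W i) (W (Suc i))" "D \<in> RelDer (W i) (ppow_field i)"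
  shows "D = (\<lambda>x. 0)"
proof (rule RelDer_Int_trivial[OF power_towerD(1)[OF W] D])
  show "W i \<subseteq> compositum (W (Suc i)) (ppow_field i)" using power_towerD(2)[OF W, of i "Suc i"] by simp
qed (use power_towerD(3,4)[OF W] in auto)

text \<open>The root \<open>z\<close> is chosen so that the \<open>p^i\<close>-th power of a core
  element is the \<open>p\<close>-th power of something still in \<open>ppow_field i\<close>;
  derivations of fields containing \<open>ppow_field i\<close> therefore kill it.\<close>

lemma perfect_core_char_power:
  assumes "y \<in> (perfect_core :: 'a set)"
  shows "\<exists>z. y = z ^ CHAR('a) \<and> y ^ (CHAR('a) ^ i) = (z ^ (CHAR('a) ^ i)) ^ CHAR('a)"
proof -
  have "y \<in> ppow_field 1" using assms perfect_core_subset by blast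
  then obtain z where "y = z ^ CHAR('a)" by (auto simp: ppow_field_def)
  then show ?thesis by (intro exI[of _ z]) (simp add: power_mult[symmetric] mult.commute)
qed

text \<open>The kernel of \<open>D\<close>, pulled back along the \<open>p^i\<close>-th power map,
  is a subfield of the whole field; it contains the core and the generators.\<close>

lemma derivation_vanishes_on_ppow_field:
  fixes F :: "'a set"
  assumes F: "subfield F" "ppow_field i \<subseteq> F" and D: "derivation F D"
    and S: "gen_field (perfect_core \<union> S) = UNIV" "\<And>s. s \<in> S \<Longrightarrow> D (s ^ (CHAR('a) ^ i)) = 0"
  shows "D \<in> RelDer F (ppow_field i)"
proof -
  have d: "deriv_on F D" using D by (simp add: derivation_alt)
  have mem: "y ^ (CHAR('a) ^ i) \<in> F" for y using F(2) by (auto simp: ppow_field_def)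
  let ?Z = "{y. y ^ (CHAR('a) ^ i) \<in> {x \<in> F. D x = 0}}"
  have "gen_field (perfect_core \<union> S) \<subseteq> ?Z"
  proof (rule gen_field_least)
    show "subfield ?Z" by (rule subfield_frobenius_vimage[OF subfield_kernel[OF F(1) d]])
    have "D (y ^ (CHAR('a) ^ i)) = 0" if "y \<in> perfect_core" for y
      using perfect_core_char_power[OF that, of i] deriv_on_char_power[OF char_pos d F(1) mem] by force
    then show "perfect_core \<union> S \<subseteq> ?Z" using mem S(2) by auto
  qed
  then show ?thesis using S(1) D by (auto simp: RelDer_def ppow_field_def)
qed

lemma jacobson_seq_levels:
  fixes J :: "nat \<Rightarrow> ('a \<Rightarrow> 'a) set"
  assumes J: "jacobson_seq J"
  shows "p_lie (jac_field J i) (J i)" "J i \<inter> RelDer (jac_field J i) (ppow_field i) \<subseteq> {\<lambda>x. 0}"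
proof -
  have "p_lie (jac_field J i) (J i) \<and> J i \<inter> RelDer (jac_field J i) (ppow_field i) \<subseteq> {\<lambda>x. 0}"
  proof (cases i)
    \<comment> \<open>At level 0, \<open>ppow_field 0\<close> is everything, so transversality is
      automatic.\<close>
    case 0
    then show ?thesis using J by (auto simp: jacobson_seq_def RelDer_def)
  next
    case (Suc n)
    then have "1 \<le> i" by simp
    then have "p_lie (jac_field J i) (J i)" "J i \<inter> RelDer (jac_field J i) (ppow_field i) = {\<lambda>x. 0}"
      using J unfolding jacobson_seq_def by blast+
    then show ?thesis by simp
  qed
  then show "p_lie (jac_field J i) (J i)" "J i \<inter> RelDer (jac_field J i) (ppow_field i) \<subseteq> {\<lambda>x. 0}"
    by auto
qed

section \<open>Towers and Jacobson sequences over a fixed finite generating list\<close>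

context
  fixes ss :: "'a list"
  assumes gen_ss: "gen_field (perfect_core \<union> set ss) = UNIV"
begin

text \<open>Over \<open>W (Suc i)\<close>, the field \<open>ppow_field i\<close> is generated by
  powers of the list \<open>ss\<close>: the \<open>p^i\<close>-th powers of core elements are
  already \<open>p^(i+1)\<close>-th powers.\<close>

lemma power_tower_generated:
  fixes W :: "nat \<Rightarrow> 'a set"
  assumes W: "power_tower W"
  shows "W i \<subseteq> gen_field (W (Suc i) \<union> (\<lambda>s. s ^ (CHAR('a) ^ i)) ` set ss)" (is "_ \<subseteq> ?M")
proof -
  have M: "subfield ?M" "W (Suc i) \<subseteq> ?M" using subfield_gen_field gen_field_superset by blast+
  let ?Z = "{y. y ^ (CHAR('a) ^ i) \<in> ?M}"
  have "gen_field (perfect_core \<union> set ss) \<subseteq> ?Z"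
  proof (rule gen_field_least)
    show "subfield ?Z" by (rule subfield_frobenius_vimage[OF M(1)])
    have "y ^ (CHAR('a) ^ i) \<in> ?M" if y: "y \<in> perfect_core" for y
    proof -
      obtain z where "y = z ^ CHAR('a)" "y ^ (CHAR('a) ^ i) = (z ^ (CHAR('a) ^ i)) ^ CHAR('a)"
        using perfect_core_char_power[OF y] by blast
      then have "y ^ (CHAR('a) ^ i) = z ^ (CHAR('a) ^ Suc i)" by (simp add: power_mult[symmetric] mult.commute)
      then have "y ^ (CHAR('a) ^ i) \<in> ppow_field (Suc i)" by (simp add: ppow_field_def)
      then show ?thesis using power_towerD(3)[OF W, of "Suc i"] M(2) by blast
    qed
    moreover have "s ^ (CHAR('a) ^ i) \<in> ?M" if "s \<in> set ss" for s
      using that gen_field_superset[of "W (Suc i) \<union> (\<lambda>s. s ^ (CHAR('a) ^ i)) ` set ss"] by blast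
    ultimately show "perfect_core \<union> set ss \<subseteq> ?Z" by blast
  qed
  then have "ppow_field i \<subseteq> ?M" using gen_ss by (auto simp: ppow_field_def)
  then have "compositum (W (Suc i)) (ppow_field i) \<subseteq> ?M" by (rule compositum_least[OF M])
  then show ?thesis using power_towerD(2)[OF W, of i "Suc i"] by simp
qed

lemma Ann_tower_to_jac:
  fixes W :: "nat \<Rightarrow> 'a set"
  assumes W: "power_tower W"
  shows "Ann (W i) (tower_to_jac W i) = W (Suc i)"
  unfolding tower_to_jac_def
proof (rule Ann_RelDer[OF char_pos power_towerD(1)[OF W] power_towerD(1)[OF W]])
  show "(\<lambda>s. s ^ (CHAR('a) ^ i)) ` set ss \<subseteq> W i"
    using power_towerD(3)[OF W, of i] by (auto simp: ppow_field_def)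
qed (use power_towerD(4)[OF W] power_tower_char_power[OF W] power_tower_generated[OF W] in auto)

lemma jac_to_tower_tower_to_jac:
  fixes W :: "nat \<Rightarrow> 'a set"
  assumes W: "power_tower W"
  shows "jac_to_tower (tower_to_jac W) = W"
proof
  fix i
  show "jac_to_tower (tower_to_jac W) i = W i"
    unfolding jac_to_tower_def
    by (induction i) (simp_all add: power_tower_0[OF W] Ann_tower_to_jac[OF W])
qed

lemma jacobson_seq_tower_to_jac:
  fixes W :: "nat \<Rightarrow> 'a set"
  assumes W: "power_tower W"
  shows "jacobson_seq (tower_to_jac W)"
proof -
  have field: "jac_field (tower_to_jac W) i = W i" for i
    using jac_to_tower_tower_to_jac[OF W] unfolding jac_to_tower_def by metis
  have lie: "p_lie (W i) (tower_to_jac W i)" for i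
    unfolding tower_to_jac_def by (rule p_lie_RelDer[OF power_towerD(1)[OF W]])
  have "tower_to_jac W i \<inter> RelDer (W i) (ppow_field i) = {\<lambda>x. 0}" for i
  proof -
    have "(\<lambda>x. 0) \<in> RelDer (W i) B" for B
      using p_lie_RelDer[OF power_towerD(1)[OF W]] unfolding p_lie_def by blast
    then show ?thesis
      unfolding tower_to_jac_def using power_tower_RelDer_Int[OF W] by blast
  qed
  then show ?thesis
    unfolding jacobson_seq_def field using lie lie[of 0] power_tower_0[OF W] by simp
qed

text \<open>Vanishing at the \<open>p^i\<close>-th powers of the generators means vanishing on
  \<open>ppow_field i\<close>, which transversality excludes for nonzero elements. This supplies the
  finite determination in \<open>p_lie_structure\<close>.\<close>

lemma p_lie_transversal_structure:
  fixes F :: "'a set"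
  assumes F: "subfield F" "ppow_field i \<subseteq> F" and L: "p_lie F L"
    and triv: "L \<inter> RelDer F (ppow_field i) \<subseteq> {\<lambda>x. 0}"
  shows "\<exists>xs. set xs \<subseteq> F \<and> der_has_dim F L (length xs) \<and> ext_has_dim (Ann F L) F (CHAR('a) ^ length xs)
      \<and> (\<forall>M. subfield M \<longrightarrow> Ann F L \<subseteq> M \<longrightarrow> set xs \<subseteq> M \<longrightarrow> F \<subseteq> M)"
    and "subfield (Ann F L)" and "L = RelDer F (Ann F L)"
proof -
  let ?ts = "map (\<lambda>s. s ^ (CHAR('a) ^ i)) ss"
  have ts: "set ?ts \<subseteq> F" using F(2) by (auto simp: ppow_field_def)
  have det: "D = (\<lambda>x. 0)" if "D \<in> L" "\<forall>t\<in>set ?ts. D t = 0" for D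
  proof -
    have "derivation F D" using L that(1) by (auto simp: p_lie_def Der_def)
    then have "D \<in> RelDer F (ppow_field i)"
      using that(2) by (intro derivation_vanishes_on_ppow_field[OF F _ gen_ss]) auto
    then show ?thesis using triv that(1) by blast
  qed
  note st = p_lie_structure[OF char_pos F(1) L ts det]
  show "\<exists>xs. set xs \<subseteq> F \<and> der_has_dim F L (length xs) \<and> ext_has_dim (Ann F L) F (CHAR('a) ^ length xs)
      \<and> (\<forall>M. subfield M \<longrightarrow> Ann F L \<subseteq> M \<longrightarrow> set xs \<subseteq> M \<longrightarrow> F \<subseteq> M)"
    using st(1) by blast
  show "subfield (Ann F L)" "L = RelDer F (Ann F L)" by (rule st(2,3); assumption)+
qed

text \<open>Both claims go in one induction, since the structure result at level \<open>i\<close>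
  uses both; derivations kill \<open>p\<close>-th powers, which lifts the inclusion to the next
  level.\<close>

lemma jac_field_subfield:
  fixes J :: "nat \<Rightarrow> ('a \<Rightarrow> 'a) set"
  assumes J: "jacobson_seq J"
  shows "subfield (jac_field J i) \<and> ppow_field i \<subseteq> jac_field J i"
proof (induction i)
  case 0
  show ?case by (simp add: subfield_UNIV)
next
  case (Suc i)
  note lv = jacobson_seq_levels[OF J, of i]
  have "subfield (Ann (jac_field J i) (J i))"
    using p_lie_transversal_structure(2)[OF _ _ lv] Suc by blast
  moreover have "x \<in> Ann (jac_field J i) (J i)" if x: "x \<in> ppow_field (Suc i)" for x
  proof -
    obtain y where y: "y \<in> ppow_field i" "x = y ^ CHAR('a)"
      using ppow_field_Suc_rep[OF x] by blast
    then have yF: "y \<in> jac_field J i" using Suc by blast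
    have "deriv_on (jac_field J i) D" if "D \<in> J i" for D
      using lv(1) that by (auto simp: p_lie_def Der_def derivation_alt)
    then show ?thesis
      using deriv_on_char_power[OF char_pos _ _ yF] subfield_power[OF _ yF] Suc y(2) by (auto simp: Ann_def)
  qed
  ultimately show ?case by auto
qed

lemma tower_to_jac_jac_to_tower:
  fixes J :: "nat \<Rightarrow> ('a \<Rightarrow> 'a) set"
  assumes J: "jacobson_seq J"
  shows "tower_to_jac (jac_to_tower J) = J"
proof
  fix i
  have "J i = RelDer (jac_field J i) (Ann (jac_field J i) (J i))"
    using p_lie_transversal_structure(3)[OF _ _ jacobson_seq_levels[OF J]] jac_field_subfield[OF J] by blast
  then show "tower_to_jac (jac_to_tower J) i = J i"
    by (simp add: tower_to_jac_def jac_to_tower_def)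
qed

text \<open>Let \<open>C\<close> be the compositum. A derivation of \<open>W i\<close> over
  \<open>C\<close> lies in \<open>J i\<close> and vanishes on \<open>ppow_field i\<close>, so it is
  zero by transversality. Since \<open>C\<close> is the annihilator of all such derivations,
  \<open>C = W i\<close>.\<close>

lemma power_tower_jac_to_tower:
  fixes J :: "nat \<Rightarrow> ('a \<Rightarrow> 'a) set"
  assumes J: "jacobson_seq J"
  shows "power_tower (jac_to_tower J)"
  unfolding jac_to_tower_def
proof (rule power_towerI)
  fix i
  let ?W = "jac_field J"
  show sub: "subfield (?W i)" "ppow_field i \<subseteq> ?W i" using jac_field_subfield[OF J] by auto
  let ?C = "compositum (?W (Suc i)) (ppow_field i)"
  have le: "?W (Suc i) \<subseteq> ?W i" by (auto simp: Ann_def)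
  have CW: "?C \<subseteq> ?W i" by (rule compositum_least[OF sub(1) le sub(2)])
  note lv = jacobson_seq_levels[OF J, of i]
  obtain xs where xs: "set xs \<subseteq> ?W i"
      "\<And>M. subfield M \<Longrightarrow> ?W (Suc i) \<subseteq> M \<Longrightarrow> set xs \<subseteq> M \<Longrightarrow> ?W i \<subseteq> M"
    using p_lie_transversal_structure(1)[OF sub lv] by auto
  have "?W (Suc i) \<subseteq> gen_field (?C \<union> set xs)" "set xs \<subseteq> gen_field (?C \<union> set xs)"
    using gen_field_superset[of "?C \<union> set xs"] compositum_superset(1)[of "?W (Suc i)" "ppow_field i"] by blast+
  then have gen: "?W i \<subseteq> gen_field (?C \<union> set xs)" by (rule xs(2)[OF subfield_gen_field])
  have "y ^ CHAR('a) \<in> ?C" if y: "y \<in> ?W i" for y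
  proof -
    have "deriv_on (?W i) D" if "D \<in> J i" for D
      using lv(1) that by (auto simp: p_lie_def Der_def derivation_alt)
    then have "y ^ CHAR('a) \<in> ?W (Suc i)"
      using deriv_on_char_power[OF char_pos _ sub(1) y] subfield_power[OF sub(1) y] by (auto simp: Ann_def)
    then show ?thesis using compositum_superset(1) by blast
  qed
  then have "Ann (?W i) (RelDer (?W i) ?C) = ?C"
    by (rule Ann_RelDer[OF char_pos subfield_compositum sub(1) CW _ _ xs(1) gen]) auto
  moreover have "D = (\<lambda>x. 0)" if "D \<in> RelDer (?W i) ?C" for D
  proof -
    have "D \<in> RelDer (?W i) (?W (Suc i))" "D \<in> RelDer (?W i) (ppow_field i)"
      using that compositum_superset[of "?W (Suc i)" "ppow_field i"]
        compositum_superset(2)[of "ppow_field i" "?W (Suc i)"] unfolding RelDer_def by blast+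
    moreover have "J i = RelDer (?W i) (?W (Suc i))"
      using fun_cong[OF tower_to_jac_jac_to_tower[OF J], of i] unfolding tower_to_jac_def jac_to_tower_def by simp
    ultimately show ?thesis using lv(2) by blast
  qed
  ultimately show "?W i = ?C" unfolding Ann_def by blast
qed

text \<open>If \<open>xs\<close> generates \<open>W i\<close> over \<open>W (Suc i)\<close>, the
  \<open>p\<close>-th powers of \<open>xs\<close> determine the derivations of the next level, and a
  dual system chosen among them is no longer than \<open>xs\<close>.\<close>

lemma power_tower_ranks:
  fixes W :: "nat \<Rightarrow> 'a set"
  assumes W: "power_tower W"
  shows "\<exists>r :: nat \<Rightarrow> nat. \<forall>i. der_has_dim (W i) (tower_to_jac W i) (r i) \<and> r (Suc i) \<le> r i
    \<and> ext_has_dim (W (Suc i)) (W i) (CHAR('a) ^ r i)"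
proof -
  define P where "P i xs \<longleftrightarrow> set xs \<subseteq> W i \<and> der_has_dim (W i) (tower_to_jac W i) (length xs)
    \<and> ext_has_dim (W (Suc i)) (W i) (CHAR('a) ^ length xs)
    \<and> (\<forall>M. subfield M \<longrightarrow> W (Suc i) \<subseteq> M \<longrightarrow> set xs \<subseteq> M \<longrightarrow> W i \<subseteq> M)" for i and xs :: "'a list"
  have lie: "p_lie (W i) (tower_to_jac W i)" for i
    unfolding tower_to_jac_def by (rule p_lie_RelDer[OF power_towerD(1)[OF W]])
  have triv: "D = (\<lambda>x. 0)" if "D \<in> tower_to_jac W i" "D \<in> RelDer (W i) (ppow_field i)" for D i
    using power_tower_RelDer_Int[OF W] that unfolding tower_to_jac_def by blast
  have "\<exists>xs. P 0 xs"
    using p_lie_transversal_structure(1)[OF power_towerD(1)[OF W, of 0] power_towerD(3)[OF W, of 0] lie[of 0]] triv[of _ 0]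
    unfolding P_def Ann_tower_to_jac[OF W] by blast
  moreover have "\<exists>ys. P (Suc i) ys \<and> length ys \<le> length xs" if "P i xs" for i xs
  proof -
    have xs: "set xs \<subseteq> W i"
        "\<And>M. subfield M \<Longrightarrow> W (Suc i) \<subseteq> M \<Longrightarrow> set xs \<subseteq> M \<Longrightarrow> W i \<subseteq> M"
      using that unfolding P_def by auto
    let ?ts = "map (\<lambda>x. x ^ CHAR('a)) xs"
    have ts: "set ?ts \<subseteq> W (Suc i)" using power_tower_char_power[OF W] xs(1) by auto
    have det: "D = (\<lambda>x. 0)" if D: "D \<in> tower_to_jac W (Suc i)" "\<forall>t\<in>set ?ts. D t = 0" for D
    proof (rule triv[OF D(1)])
      have der: "derivation (W (Suc i)) D" using D(1) by (simp add: tower_to_jac_def RelDer_def)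
      then have d: "deriv_on (W (Suc i)) D" by (simp add: derivation_alt)
      let ?Z = "{y. y ^ (CHAR('a) ^ 1) \<in> {x \<in> W (Suc i). D x = 0}}"
      \<comment> \<open>Generation of \<open>W i\<close> is pulled through Frobenius: vanishing at
        the powers of \<open>xs\<close> becomes vanishing at the \<open>p\<close>-th power of every
        element of \<open>W i\<close>.\<close>
      have "W i \<subseteq> ?Z"
      proof (rule xs(2))
        show "subfield ?Z"
          by (rule subfield_frobenius_vimage[OF subfield_kernel[OF power_towerD(1)[OF W] d]])
        show "W (Suc i) \<subseteq> ?Z"
          using deriv_on_char_power[OF char_pos d power_towerD(1)[OF W]]
            subfield_power[OF power_towerD(1)[OF W]] by auto
        show "set xs \<subseteq> ?Z" using ts D(2) by auto
      qed
      then have "D (y ^ CHAR('a)) = 0" if "y \<in> ppow_field i" for y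
        using power_towerD(3)[OF W, of i] that by auto
      then have "D x = 0" if "x \<in> ppow_field (Suc i)" for x
        using ppow_field_Suc_rep[of x i] that by auto
      then show "D \<in> RelDer (W (Suc i)) (ppow_field (Suc i))" using der by (simp add: RelDer_def)
    qed
    have "\<exists>ys. length ys \<le> length ?ts \<and> P (Suc i) ys"
      using p_lie_structure(1)[OF char_pos power_towerD(1)[OF W] lie ts det]
      unfolding P_def Ann_tower_to_jac[OF W] .
    then show ?thesis by auto
  qed
  \<comment> \<open>The lists are chosen successively, each relative to its predecessor; their
    lengths are the ranks.\<close>
  ultimately obtain f where "\<forall>i. P i (f i) \<and> length (f (Suc i)) \<le> length (f i)"
    using dependent_nat_choice[of P "\<lambda>_ xs ys. length ys \<le> length xs"] by blast
  then show ?thesis unfolding P_def by (intro exI[of _ "\<lambda>i. length (f i)"]) blast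
qed

end

text \<open>A restriction that is a derivation kills some \<open>W n\<close> and all
  \<open>p\<close>-th powers from \<open>W i\<close>, hence a compositum equal to
  \<open>W (Suc i)\<close>. Conversely, a derivation over \<open>W (Suc i)\<close> is linear and
  extends to a linear operator on the whole field, which lies in \<open>DD\<close>.\<close>

lemma unpack_eq:
  assumes fin_gen: "fin_gen_over (perfect_core :: 'a set)" and DD: "K_subalg (DD :: ('a \<Rightarrow> 'a) set)"
  shows "unpack DD = tower_to_jac (alg_to_tower DD)"
proof
  fix i
  define W where "W = alg_to_tower DD"
  have W: "power_tower W" unfolding W_def by (rule power_tower_alg_to_tower[OF char_pos fin_gen DD])
  have "DD = tower_to_alg W"
    unfolding W_def by (rule tower_to_alg_alg_to_tower[OF char_pos fin_gen DD, symmetric])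
  then have mem: "D \<in> DD \<longleftrightarrow> (\<exists>n. lin_op (W n) D)" for D
    by (simp add: tower_to_alg_def Diff_power_tower[OF char_pos fin_gen W])
  note Wi = power_towerD(1)[OF W, of i]
  have "E \<in> RelDer (W i) (W (Suc i))" if E: "E \<in> Der (W i)" and D: "D \<in> DD" "E = restr (W i) D" for E D
  proof -
    have der: "derivation (W i) E" using E by (simp add: Der_def)
    then have d: "deriv_on (W i) E" by (simp add: derivation_alt)
    obtain m where m: "lin_op (W m) D" using D(1) mem by blast
    \<comment> \<open>Going at least to level \<open>Suc i\<close> lets the tower condition express
      \<open>W (Suc i)\<close> through \<open>W n\<close>.\<close>
    define n where "n = max m (Suc i)"
    have n: "lin_op (W n) D" "Suc i \<le> n"
      using lin_op_antimono[OF power_towerD(4)[OF W] m, of n] by (auto simp: n_def)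
    have sub: "W n \<subseteq> W i" using power_towerD(4)[OF W] n(2) by simp
    \<comment> \<open>\<open>D\<close> agrees at 1 with the derivation \<open>E\<close>, so
      linearity gives \<open>D w = w * D 1 = 0\<close> for \<open>w\<close> in
      \<open>W n\<close>.\<close>
    have "D 1 = 0" using deriv_onD(4)[OF d Wi] subfield_closed(2)[OF Wi] D(2) by (simp add: restr_def)
    then have "E w = 0" if "w \<in> W n" for w
      using lin_opD(2)[OF n(1) that, of 1] D(2) by (simp add: restr_def)
    then have "W n \<subseteq> {x \<in> W i. E x = 0}" using sub by auto
    moreover have "ppow_field (Suc i) \<subseteq> {x \<in> W i. E x = 0}"
    proof
      fix x assume "x \<in> (ppow_field (Suc i) :: 'a set)"
      then obtain y where "y \<in> ppow_field i" "x = y ^ CHAR('a)"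
        using ppow_field_Suc_rep[of x i] by auto
      moreover from this(1) have "y \<in> W i" using power_towerD(3)[OF W] by blast
      ultimately show "x \<in> {x \<in> W i. E x = 0}"
        using deriv_on_char_power[OF char_pos d Wi] subfield_power[OF Wi] by simp
    qed
    ultimately have "compositum (W n) (ppow_field (Suc i)) \<subseteq> {x \<in> W i. E x = 0}"
      by (intro compositum_least[OF subfield_kernel[OF Wi d]])
    then show ?thesis using power_towerD(2)[OF W n(2)] der by (auto simp: RelDer_def)
  qed
  moreover have "E \<in> Der (W i) \<and> (\<exists>D\<in>DD. E = restr (W i) D)" if E: "E \<in> RelDer (W i) (W (Suc i))" for E
  proof -
    have der: "derivation (W i) E" "\<And>a. a \<in> W (Suc i) \<Longrightarrow> E a = 0" using E by (auto simp: RelDer_def)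
    have le: "W (Suc i) \<subseteq> W i" using power_towerD(4)[OF W] by simp
    have "lin_on (W (Suc i)) (W i) E"
      using der le unfolding lin_on_def derivation_alt deriv_on_def by (auto simp: subset_iff)
    then obtain D where "lin_op (W (Suc i)) D" "\<forall>v\<in>W i. D v = E v"
      using lin_on_extend[OF power_towerD(1)[OF W] subspace_over_subfield[OF Wi le] _
          finite_over_UNIV[OF char_pos fin_gen power_towerD(3)[OF W]]] by blast
    moreover from this have "E = restr (W i) D" using der(1) by (auto simp: restr_def derivation_alt fun_eq_iff)
    ultimately show ?thesis using der(1) mem by (auto simp: Der_def)
  qed
  ultimately show "unpack DD i = tower_to_jac (alg_to_tower DD) i"
    unfolding unpack_def tower_to_jac_def W_def[symmetric] by blast
qed

end

theorem mainTheorem1: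
  assumes "CHAR('a::field) > 0"
    and "fin_gen_over (perfect_core :: 'a set)"
  shows
    "bij_betw tower_to_jac {W :: nat \<Rightarrow> 'a set. power_tower W} {F. jacobson_seq F}
   \<and> bij_betw jac_to_tower {F :: nat \<Rightarrow> ('a \<Rightarrow> 'a) set. jacobson_seq F} {W. power_tower W}
   \<and> (\<forall>W :: nat \<Rightarrow> 'a set. power_tower W \<longrightarrow> jac_to_tower (tower_to_jac W) = W)
   \<and> (\<forall>F :: nat \<Rightarrow> ('a \<Rightarrow> 'a) set. jacobson_seq F \<longrightarrow> tower_to_jac (jac_to_tower F) = F)
   \<and> bij_betw tower_to_alg {W :: nat \<Rightarrow> 'a set. power_tower W} {DD. K_subalg DD}
   \<and> (\<forall>W :: nat \<Rightarrow> 'a set. power_tower W \<longrightarrow> alg_to_tower (tower_to_alg W) = W)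
   \<and> (\<forall>DD :: ('a \<Rightarrow> 'a) set. K_subalg DD \<longrightarrow> power_tower (alg_to_tower DD)
          \<and> tower_to_alg (alg_to_tower DD) = DD)
   \<and> bij_betw unpack {DD :: ('a \<Rightarrow> 'a) set. K_subalg DD} {F. jacobson_seq F}
   \<and> (\<forall>DD :: ('a \<Rightarrow> 'a) set. K_subalg DD \<longrightarrow> unpack DD = tower_to_jac (alg_to_tower DD))
   \<and> (\<forall>W :: nat \<Rightarrow> 'a set. power_tower W \<longrightarrow>
        (\<exists>r :: nat \<Rightarrow> nat. \<forall>i.
            der_has_dim (W i) (tower_to_jac W i) (r i)
          \<and> r (Suc i) \<le> r i
          \<and> ext_has_dim (W (Suc i)) (W i) (CHAR('a) ^ r i)))"
proof -
  obtain S :: "'a set" where "finite S" "gen_field (perfect_core \<union> S) = UNIV"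
    using assms(2) unfolding fin_gen_over_def by auto
  then obtain ss :: "'a list" where ss: "gen_field (perfect_core \<union> set ss) = UNIV"
    using finite_list by blast
  note jt = jac_to_tower_tower_to_jac[OF assms(1) ss]
  note tj = tower_to_jac_jac_to_tower[OF assms(1) ss]
  note jac = jacobson_seq_tower_to_jac[OF assms(1) ss]
  note tower = power_tower_jac_to_tower[OF assms(1) ss]
  note at = alg_to_tower_tower_to_alg[OF assms]
  note ta = tower_to_alg_alg_to_tower[OF assms]
  note alg = K_subalg_tower_to_alg[OF assms]
  note tower' = power_tower_alg_to_tower[OF assms]
  note unpack = unpack_eq[OF assms]
  have "bij_betw tower_to_jac {W :: nat \<Rightarrow> 'a set. power_tower W} {F. jacobson_seq F}"
    by (rule bij_betw_byWitness[of _ jac_to_tower]) (use jt tj jac tower in auto)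
  moreover have "bij_betw jac_to_tower {F :: nat \<Rightarrow> ('a \<Rightarrow> 'a) set. jacobson_seq F} {W. power_tower W}"
    by (rule bij_betw_byWitness[of _ tower_to_jac]) (use jt tj jac tower in auto)
  moreover have "bij_betw tower_to_alg {W :: nat \<Rightarrow> 'a set. power_tower W} {DD. K_subalg DD}"
    by (rule bij_betw_byWitness[of _ alg_to_tower]) (use at ta alg tower' in auto)
  moreover have "bij_betw unpack {DD :: ('a \<Rightarrow> 'a) set. K_subalg DD} {F. jacobson_seq F}"
    \<comment> \<open>Unpacking is \<open>tower_to_jac\<close> after \<open>alg_to_tower\<close>, so
      its inverse composes the two inverses in the opposite order.\<close>
    by (rule bij_betw_byWitness[of _ "\<lambda>F. tower_to_alg (jac_to_tower F)"])
      (use at ta alg tower' jt tj jac tower unpack in auto)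
  ultimately show ?thesis
    using jt tj at ta tower' unpack power_tower_ranks[OF assms(1) ss] by blast
qed

end
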